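(* Suppose that Assumptions 1, 2 and 3 (stated in the context) all hold, that $k\ge2$, and that $C_p$ in Assumption 3 is a positive constant (independent of the mesh and model parameters). Then $\kappa(B^{-1}_{k,\bar\psi}A_h)$ is bounded by a constant depending only on $\Lambda$ and $M$ (the constants $\tilde C$, $C_{I_a}$, $C_{I_s}$, $C_p$ of the assumptions and the dimension $d$ being regarded as fixed).
   Context: Setting. $\Omega\subset\mathbb{R}^d$ ($d\ge1$) is a bounded polygonal (polyhedral) domain, $V(\Omega)$ is a complex Hilbert space of functions on $\Omega$, $a(\cdot,\cdot)$ is a sesquilinear Hermitian positive definite form, and $V_h$ is a finite-dimensional space of functions associated with a partition $\mathcal{T}_h$ of $\Omega$. With a fixed inner product $(\cdot,\cdot)$ on $V_h$, $A_h:V_h\to V_h$ is defined by $(A_hu,v)=a(u,v)$. For a region $\mathcal D\subset\bar\Omega$, $a(\cdot,\cdot)_{\mathcal D}$ is the restriction of $a$ to $\mathcal D$ (nonnegative, additive over nonoverlapping regions), and $|u|_{a(\mathcal D)}^2=a(u,u)_{\mathcal D}$. The forms are understood to be defined also on products of functions of $V_h$ with the cutoff functions below. Subdomains. $\bar\Omega=\bigcup_{i=1}^N\bar\Omega_i$ with $\Omega_i\cap\Omega_j=\emptyset$ ($i\ne j$), of size $H$; $\Omega_i'\supset\Omega_i$ is obtained by extending $\Omega_i$ by several layers of elements of $\mathcal{T}_h$. Put $a_i=a(\cdot,\cdot)_{\bar\Omega_i}$, so $a=\sum_i a_i$; $V_h(\bar\Omega_i)=V_h|_{\bar\Omega_i}$,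 $n_i=\dim V_h(\bar\Omega_i)$; $V_h(\Omega_i')=\{u\in V_h:\mathrm{supp}(u)\subseteq\Omega_i'\}$; $\mathcal S^{(i)}=\{1\le j\le N:\Omega_j'\cap\Omega_i'\ne\emptyset\}$; $M=\max_i|\mathcal S^{(i)}|$. $\{\theta_i\}_{i=1}^N$ is a partition of unity: $\sum_i\theta_i=1$, $0\le\theta_i\le1$ on $\bar\Omega$, $\mathrm{supp}(\theta_i)\subset\bar\Omega_i'$. Assumption 1. There are sesquilinear Hermitian positive definite forms $s_i(\cdot,\cdot)$ on $V_h(\bar\Omega_i)$ and a constant $\tilde C>0$ with $a_i(\theta_ju,\theta_ju)\le\tilde C(a_i(u,u)+s_i(u,u))$ for all $u\in V_h$, $j\in\mathcal S^{(i)}$, $i=1,\dots,N$; and $\|\eta u\|_{s_i}\le\|\eta\|_{L^\infty(\bar\Omega_i)}\|u\|_{s_i}$ for all $\eta\in L^\infty(\bar\Omega_i)$, where $\|u\|_{s_i}=\sqrt{s_i(u,u)}$. Assumption 2. $I_h:L^2(\Omega)\to V_h$ is an interpolation operator (linear, $I_hv=v$ for $v\in V_h$, $I_h(\theta_iv)\in V_h(\Omega_i')$ for $v\in V_h$), and there are constants $C_{I_a},C_{I_s}$ such that for all $u\in V(\Omega)$: $a(I_hu,I_hu)_\tau\le C_{I_a}a(u,u)_\tau$ for all $\tau\in\mathcal T_h$, and $\sum_{l=1}^N\|I_hu\|_{s_l}^2\le C_{I_s}\sum_{l=1}^N\|u\|_{s_l}^2$. It is applied also to products of functions of $V_h$ with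 sums of the $\theta_i$. Coarse space. $\Lambda>1$ is a user-defined threshold. On each $\Omega_i$ consider $s_i(\phi,w)=\lambda a_i(\phi,w)$ for all $w\in V_h(\bar\Omega_i)$, whose $n_i$ eigenvalues are positive reals ordered as $\lambda_1^{(i)}\ge\dots\ge\lambda_{l_i}^{(i)}\ge\Lambda>\lambda_{l_i+1}^{(i)}\ge\dots\ge\lambda_{n_i}^{(i)}>0$, with eigenfunctions $\phi_j^{(i)}$ that are $s_i$-orthonormal and $a_i$-orthogonal. $V_{aux}^{(i)}=\mathrm{span}\{\phi_1^{(i)},\dots,\phi_{l_i}^{(i)}\}$. $\pi_i:V_h\to V_{aux}^{(i)}$ is defined by $s_i(\pi_iv,w)=s_i(v,w)$ for all $w\in V_{aux}^{(i)}$. $\tilde V=\{v\in V_h: s_i(v,w)=0\ \forall w\in V_{aux}^{(i)},\ i=1,\dots,N\}$, and $V_0$ is the $a(\cdot,\cdot)$-orthogonal complement of $\tilde V$ in $V_h$. Assumption 3. There is a constant $C_p>0$ with $\sum_{l=1}^N\|\pi_lu_0\|_{s_l}^2\lesssim C_p|u_0|_{a(\Omega)}^2$ for all $u_0\in V_0$, with the constant in $\lesssim$ independent of the mesh and model parameters. Economical preconditioner. $b(u,v)=a(u,v)+\sum_{l=1}^Ns_l(\pi_lu,\pi_lv)$ on $V_h$. For an integer $k$, $\Omega_{k,H}^{(i)}$ is the region obtained by extending $\Omega_i$ with $k$ layers of neighbouring subdomains, and $V_{k,H}^{(i)}=\{v\in V_h:\mathrm{supp}(v)\subseteq\Omega_{k,H}^{(i)}\}$.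 $\bar\psi_{j,k}^{(i)}\in V_{k,H}^{(i)}$ is defined by $b(\bar\psi_{j,k}^{(i)},v)=s_i(\phi_j^{(i)},\pi_iv)$ for all $v\in V_{k,H}^{(i)}$, and $V_0^{k,\bar\psi}=\mathrm{span}\{\bar\psi_{j,k}^{(i)}:1\le j\le l_i,1\le i\le N\}$. Then $$B_{k,\bar\psi}^{-1}=\sum_{j=1}^N\Pi_jA_j^{-1}\Pi_j^*+\Pi_0^{k,\bar\psi}(A_0^{k,\bar\psi})^{-1}(\Pi_0^{k,\bar\psi})^*,$$ where $A_j:V_h(\Omega_j')\to V_h(\Omega_j')$, $(A_ju,v)=a(u,v)_{\Omega_j'}$; $A_0^{k,\bar\psi}:V_0^{k,\bar\psi}\to V_0^{k,\bar\psi}$, $(A_0^{k,\bar\psi}u,v)=a(u,v)$; $\Pi_j:V_h(\Omega_j')\to V_h$, $\Pi_0^{k,\bar\psi}:V_0^{k,\bar\psi}\to V_h$ are inclusions, with adjoints denoted by $*$. $\kappa$ denotes the condition number. *)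

theory Defs
  imports "HOL-Probability.Essential_Supremum" "HOL-Library.Function_Algebras"
begin

type_synonym 'p cfun = "'p \<Rightarrow> complex"

definition cscale :: "complex \<Rightarrow> 'p cfun \<Rightarrow> 'p cfun" where
  "cscale c u = (\<lambda>x. c * u x)"

global_interpretation cfun: vector_space "cscale :: complex \<Rightarrow> 'p cfun \<Rightarrow> 'p cfun"
  by standard (auto simp: cscale_def fun_eq_iff algebra_simps)

text \<open>Forms are linear in the first and conjugate-linear in the second argument (the latter
  follows from Hermitian symmetry).\<close>

definition hermitian_form_on :: "'p cfun set \<Rightarrow> ('p cfun \<Rightarrow> 'p cfun \<Rightarrow> complex) \<Rightarrow> bool" where
  "hermitian_form_on W B \<longleftrightarrow>
     (\<forall>u\<in>W. \<forall>v\<in>W. \<forall>w\<in>W. B (u + v) w = B u w + B v w) \<and>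
     (\<forall>c. \<forall>u\<in>W. \<forall>w\<in>W. B (cscale c u) w = c * B u w) \<and>
     (\<forall>u\<in>W. \<forall>v\<in>W. B v u = cnj (B u v))"

text \<open>The quadratic form \<open>B(u,u)\<close>, which is real because the form is Hermitian.\<close>

definition qf :: "('p cfun \<Rightarrow> 'p cfun \<Rightarrow> complex) \<Rightarrow> 'p cfun \<Rightarrow> real" where
  "qf B u = Re (B u u)"

definition nonneg_form_on :: "'p cfun set \<Rightarrow> ('p cfun \<Rightarrow> 'p cfun \<Rightarrow> complex) \<Rightarrow> bool" where
  "nonneg_form_on W B \<longleftrightarrow> hermitian_form_on W B \<and> (\<forall>u\<in>W. 0 \<le> qf B u)"

definition pos_def_form_on :: "'p cfun set \<Rightarrow> ('p cfun \<Rightarrow> 'p cfun \<Rightarrow> complex) \<Rightarrow> bool" where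
  "pos_def_form_on W B \<longleftrightarrow> hermitian_form_on W B \<and> (\<forall>u\<in>W. u \<noteq> 0 \<longrightarrow> 0 < qf B u)"

text \<open>The element of \<open>W\<close> that represents the functional \<open>f\<close>; it exists and is
  unique when \<open>W\<close> is finite-dimensional, \<open>B\<close> is positive definite on \<open>W\<close>
  and \<open>f\<close> is conjugate-linear on \<open>W\<close>, which is the case at every use below.\<close>

definition riesz :: "('p cfun \<Rightarrow> 'p cfun \<Rightarrow> complex) \<Rightarrow> 'p cfun set \<Rightarrow> ('p cfun \<Rightarrow> complex) \<Rightarrow> 'p cfun" where
  "riesz B W f = (THE w. w \<in> W \<and> (\<forall>v\<in>W. B w v = f v))"

text \<open>The operator \<open>A : W \<rightarrow> W\<close> with \<open>(A u, v) = f(u, v)\<close> for \<open>v \<in> W\<close>.\<close>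

definition form_op where
  "form_op ip f W u = riesz ip W (\<lambda>v. f u v)"

text \<open>The adjoint, with respect to \<open>ip\<close>, of the inclusion of \<open>W\<close> into a larger space.\<close>

definition incl_adj where
  "incl_adj ip W u = riesz ip W (\<lambda>v. ip u v)"

text \<open>The spectral condition number (largest over smallest modulus of the eigenvalues) of
  \<open>T : W \<rightarrow> W\<close>, as is usual for preconditioned operators, which are self-adjoint and
  positive only with respect to the energy form. It is infinite if \<open>T\<close> is singular, and
  it is \<open>0\<close> if \<open>W = {0}\<close>.\<close>

definition eigenvalues_on :: "'p cfun set \<Rightarrow> ('p cfun \<Rightarrow> 'p cfun) \<Rightarrow> complex set" where
  "eigenvalues_on W T = {\<mu>. \<exists>u\<in>W. u \<noteq> 0 \<and> T u = cscale \<mu> u}"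

definition cond_number :: "'p cfun set \<Rightarrow> ('p cfun \<Rightarrow> 'p cfun) \<Rightarrow> ennreal" where
  "cond_number W T =
     (if 0 \<in> eigenvalues_on W T then top
      else (SUP \<mu>\<in>eigenvalues_on W T. ennreal (cmod \<mu>)) /
           (INF \<mu>\<in>eigenvalues_on W T. ennreal (cmod \<mu>)))"

text \<open>Functions on a set \<open>D\<close> are represented by functions on the whole space that
  vanish off \<open>D\<close>.\<close>

definition restr :: "'p set \<Rightarrow> 'p cfun \<Rightarrow> 'p cfun" where
  "restr D u = (\<lambda>x. if x \<in> D then u x else 0)"

definition supp :: "('p::topological_space \<Rightarrow> 'b::zero) \<Rightarrow> 'p set" where
  "supp u = closure {x. u x \<noteq> 0}"

definition ae_eq_on :: "'p::euclidean_space set \<Rightarrow> 'p cfun \<Rightarrow> 'p cfun \<Rightarrow> bool" where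
  "ae_eq_on D u v \<longleftrightarrow> (AE x in lebesgue_on D. u x = v x)"

definition L2_on :: "'p::euclidean_space set \<Rightarrow> 'p cfun set" where
  "L2_on D = {u. u \<in> borel_measurable (lebesgue_on D) \<and>
                 integrable (lebesgue_on D) (\<lambda>x. (cmod (u x))\<^sup>2)}"

definition Linf_norm :: "'p::euclidean_space set \<Rightarrow> 'p cfun \<Rightarrow> ereal" where
  "Linf_norm D \<eta> = esssup (lebesgue_on D) (\<lambda>x. ereal (cmod (\<eta> x)))"

definition Linf_on :: "'p::euclidean_space set \<Rightarrow> 'p cfun set" where
  "Linf_on D = {\<eta>. \<eta> \<in> borel_measurable (lebesgue_on D) \<and> Linf_norm D \<eta> < \<infinity>}"

text \<open>A complex Hilbert space of functions on \<open>D\<close>, the functions being identified when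
  they agree almost everywhere.\<close>

definition hilbert_fun_space ::
    "'p::euclidean_space set \<Rightarrow> 'p cfun set \<Rightarrow> ('p cfun \<Rightarrow> 'p cfun \<Rightarrow> complex) \<Rightarrow> bool" where
  "hilbert_fun_space D V B \<longleftrightarrow>
     cfun.subspace V \<and> nonneg_form_on V B \<and>
     (\<forall>u\<in>V. qf B u = 0 \<longleftrightarrow> ae_eq_on D u 0) \<and>
     (\<forall>f. range f \<subseteq> V \<and>
          (\<forall>e>0. \<exists>n0::nat. \<forall>m\<ge>n0. \<forall>n\<ge>n0. sqrt (qf B (f m - f n)) < e) \<longrightarrow>
          (\<exists>g\<in>V. (\<lambda>n. sqrt (qf B (f n - g))) \<longlonglongrightarrow> 0))"

text \<open>A bounded domain whose boundary is a finite union of \<open>(d-1)\<close>-dimensional polytopes.\<close>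

definition polyhedral_domain :: "'p::euclidean_space set \<Rightarrow> bool" where
  "polyhedral_domain D \<longleftrightarrow>
     open D \<and> connected D \<and> bounded D \<and> D \<noteq> {} \<and>
     (\<exists>F. finite F \<and> frontier D = \<Union>F \<and>
          (\<forall>P\<in>F. polytope P \<and> aff_dim P = int DIM('p) - 1))"

text \<open>
  \<^item> \<open>Omega\<close>, \<open>mesh\<close>: the domain and its partition into closed elements;
  \<^item> \<open>V_space\<close>, \<open>V_ip\<close>: the Hilbert space \<open>V(\<Omega>)\<close> and its inner product;
  \<^item> \<open>Vh\<close>, \<open>Vh_ip\<close>: the discrete space and the inner product that defines \<open>A_h\<close>;
  \<^item> \<open>aform D\<close>: the form \<open>a\<close> restricted to the region \<open>D\<close>;
  \<^item> \<open>nsub\<close>, \<open>sub i\<close>, \<open>ovl i\<close>: the number \<open>N\<close>, the open sets \<open>\<Omega>\<^sub>i\<close> and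
    \<open>\<Omega>\<^sub>i'\<close> for \<open>1 \<le> i \<le> N\<close>;
  \<^item> \<open>pou i\<close>, \<open>sform i\<close>, \<open>interp\<close>: the functions \<open>\<theta>\<^sub>i\<close>, the forms \<open>s\<^sub>i\<close> and
    the interpolation \<open>I_h\<close>;
  \<^item> \<open>eigfun i j\<close>, \<open>eigval i j\<close>: the eigenpairs on \<open>\<Omega>\<^sub>i\<close>, for
    \<open>1 \<le> j \<le> n\<^sub>i\<close>.
\<close>

record 'p schwarz =
  Omega :: "'p set"
  mesh :: "'p set set"
  V_space :: "'p cfun set"
  V_ip :: "'p cfun \<Rightarrow> 'p cfun \<Rightarrow> complex"
  Vh :: "'p cfun set"
  Vh_ip :: "'p cfun \<Rightarrow> 'p cfun \<Rightarrow> complex"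
  aform :: "'p set \<Rightarrow> 'p cfun \<Rightarrow> 'p cfun \<Rightarrow> complex"
  nsub :: nat
  sub :: "nat \<Rightarrow> 'p set"
  ovl :: "nat \<Rightarrow> 'p set"
  pou :: "nat \<Rightarrow> 'p \<Rightarrow> real"
  sform :: "nat \<Rightarrow> 'p cfun \<Rightarrow> 'p cfun \<Rightarrow> complex"
  interp :: "'p cfun \<Rightarrow> 'p cfun"
  eigfun :: "nat \<Rightarrow> nat \<Rightarrow> 'p cfun"
  eigval :: "nat \<Rightarrow> nat \<Rightarrow> real"

definition mesh_partition :: "'p::euclidean_space set \<Rightarrow> 'p set set \<Rightarrow> bool" where
  "mesh_partition D T \<longleftrightarrow>
     finite T \<and> \<Union>T = closure D \<and>
     (\<forall>\<tau>\<in>T. interior \<tau> \<subseteq> D \<and> (\<exists>E. polyhedral_domain E \<and> \<tau> = closure E)) \<and>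
     (\<forall>\<sigma>\<in>T. \<forall>\<tau>\<in>T. \<sigma> \<noteq> \<tau> \<longrightarrow> interior \<sigma> \<inter> interior \<tau> = {})"

definition add_layer :: "'p set set \<Rightarrow> 'p set set \<Rightarrow> 'p set set" where
  "add_layer T U = {\<tau>\<in>T. \<exists>\<sigma>\<in>U. \<sigma> \<inter> \<tau> \<noteq> {}}"

definition geometry :: "'p::euclidean_space schwarz \<Rightarrow> bool" where
  "geometry S \<longleftrightarrow>
     polyhedral_domain (Omega S) \<and> mesh_partition (Omega S) (mesh S) \<and>
     closure (Omega S) = (\<Union>i\<in>{1..nsub S}. closure (sub S i)) \<and>
     (\<forall>i\<in>{1..nsub S}. \<forall>j\<in>{1..nsub S}. i \<noteq> j \<longrightarrow> sub S i \<inter> sub S j = {}) \<and>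
     (\<forall>i\<in>{1..nsub S}. open (sub S i) \<and> sub S i \<noteq> {} \<and> sub S i \<subseteq> Omega S \<and>
        (\<exists>U\<subseteq>mesh S. closure (sub S i) = \<Union>U \<and>
           (\<exists>m\<ge>1. ovl S i = interior (\<Union> ((add_layer (mesh S) ^^ m) U)))))"

text \<open>The index set \<open>\<S>\<^sup>(\<^sup>i\<^sup>)\<close> and the number \<open>M\<close>.\<close>

definition ovl_idx :: "'p schwarz \<Rightarrow> nat \<Rightarrow> nat set" where
  "ovl_idx S i = {j\<in>{1..nsub S}. ovl S j \<inter> ovl S i \<noteq> {}}"

definition max_ovl :: "'p schwarz \<Rightarrow> nat" where
  "max_ovl S = Max ((\<lambda>i. card (ovl_idx S i)) ` {1..nsub S})"

text \<open>The region \<open>\<Omega>\<^sub>i\<close> extended by \<open>k\<close> layers of subdomains; neighbours are subdomains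
  whose closures meet.\<close>

definition add_sub_layer :: "'p::topological_space schwarz \<Rightarrow> nat set \<Rightarrow> nat set" where
  "add_sub_layer S J = {l\<in>{1..nsub S}. \<exists>j\<in>J. closure (sub S j) \<inter> closure (sub S l) \<noteq> {}}"

definition layer_region :: "'p::topological_space schwarz \<Rightarrow> nat \<Rightarrow> nat \<Rightarrow> 'p set" where
  "layer_region S k i = (\<Union>j\<in>(add_sub_layer S ^^ k) {i}. closure (sub S j))"

definition a_full :: "'p::topological_space schwarz \<Rightarrow> 'p cfun \<Rightarrow> 'p cfun \<Rightarrow> complex" where
  "a_full S = aform S (closure (Omega S))"

definition a_sub :: "'p::topological_space schwarz \<Rightarrow> nat \<Rightarrow> 'p cfun \<Rightarrow> 'p cfun \<Rightarrow> complex" where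
  "a_sub S i = aform S (closure (sub S i))"

definition Vh_sub :: "'p::topological_space schwarz \<Rightarrow> nat \<Rightarrow> 'p cfun set" where
  "Vh_sub S i = restr (closure (sub S i)) ` Vh S"

definition Vh_supp :: "'p::topological_space schwarz \<Rightarrow> 'p set \<Rightarrow> 'p cfun set" where
  "Vh_supp S D = {u\<in>Vh S. supp u \<subseteq> D}"

text \<open>\<open>V_h(\<Omega>\<^sub>i')\<close>. As \<open>\<Omega>\<^sub>i'\<close> is taken open and supports are closed, the support is
  required to lie in the closure of \<open>\<Omega>\<^sub>i'\<close>.\<close>

definition Vh_ovl :: "'p::topological_space schwarz \<Rightarrow> nat \<Rightarrow> 'p cfun set" where
  "Vh_ovl S i = Vh_supp S (closure (ovl S i))"

definition cutoff_products :: "'p schwarz \<Rightarrow> 'p cfun set" where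
  "cutoff_products S =
     {(\<lambda>x. of_real (\<Sum>i\<in>J. pou S i x) * v x) | J v. J \<subseteq> {1..nsub S} \<and> v \<in> Vh S}"

text \<open>The functions that can be inserted in the form on the region \<open>D\<close>: those that agree
  almost everywhere on \<open>D\<close> with an element of the span of \<open>V(\<Omega>)\<close>, \<open>V_h\<close> and the
  products with cutoff functions. For \<open>s\<^sub>i\<close>, products with all of
  \<open>L\<^sup>\<infinity>\<close> are admitted as well.\<close>

definition a_dom :: "'p::euclidean_space schwarz \<Rightarrow> 'p set \<Rightarrow> 'p cfun set" where
  "a_dom S D = {u. \<exists>w\<in>cfun.span (V_space S \<union> Vh S \<union> cutoff_products S). ae_eq_on D u w}"

definition s_dom :: "'p::euclidean_space schwarz \<Rightarrow> nat \<Rightarrow> 'p cfun set" where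
  "s_dom S i =
     {u. \<exists>w\<in>cfun.span (V_space S \<union> Vh S \<union>
                {\<eta> * v | \<eta> v. \<eta> \<in> Linf_on (closure (sub S i)) \<and> v \<in> Vh S}).
          ae_eq_on (closure (sub S i)) u w}"

text \<open>As forms on function classes restricted to \<open>D\<close>, \<open>a(\<cdot>,\<cdot>)\<^sub>D\<close> and \<open>s\<^sub>i\<close> only see
  the values almost everywhere on \<open>D\<close>, respectively on the subdomain.\<close>

definition spaces_and_forms :: "'p::euclidean_space schwarz \<Rightarrow> bool" where
  "spaces_and_forms S \<longleftrightarrow>
     hilbert_fun_space (Omega S) (V_space S) (V_ip S) \<and> V_space S \<subseteq> L2_on (Omega S) \<and>
     (\<exists>B. finite B \<and> Vh S = cfun.span B) \<and> Vh S \<subseteq> L2_on (Omega S) \<and>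
     (\<forall>u\<in>Vh S. \<forall>x. x \<notin> closure (Omega S) \<longrightarrow> u x = 0) \<and>
     pos_def_form_on (Vh S) (Vh_ip S) \<and>
     (\<forall>U\<subseteq>mesh S. nonneg_form_on (a_dom S (\<Union>U)) (aform S (\<Union>U)) \<and>
        (\<forall>u\<in>a_dom S (\<Union>U). \<forall>u'\<in>a_dom S (\<Union>U). \<forall>v\<in>a_dom S (\<Union>U).
           ae_eq_on (\<Union>U) u u' \<longrightarrow> aform S (\<Union>U) u v = aform S (\<Union>U) u' v)) \<and>
     (\<forall>U\<subseteq>mesh S. \<forall>W\<subseteq>mesh S. U \<inter> W = {} \<longrightarrow>
        (\<forall>u\<in>a_dom S (\<Union>(U \<union> W)). \<forall>v\<in>a_dom S (\<Union>(U \<union> W)).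
           aform S (\<Union>(U \<union> W)) u v = aform S (\<Union>U) u v + aform S (\<Union>W) u v)) \<and>
     (\<forall>u\<in>V_space S. qf (a_full S) u = 0 \<longrightarrow> ae_eq_on (Omega S) u 0) \<and>
     pos_def_form_on (Vh S) (a_full S)"

definition partition_of_unity :: "'p::euclidean_space schwarz \<Rightarrow> bool" where
  "partition_of_unity S \<longleftrightarrow>
     (\<forall>x\<in>closure (Omega S). (\<Sum>i\<in>{1..nsub S}. pou S i x) = 1) \<and>
     (\<forall>i\<in>{1..nsub S}. pou S i \<in> borel_measurable (lebesgue_on (Omega S)) \<and>
        (\<forall>x\<in>closure (Omega S). 0 \<le> pou S i x \<and> pou S i x \<le> 1) \<and>
        supp (pou S i) \<subseteq> closure (ovl S i))"

definition assumption1 :: "'p::euclidean_space schwarz \<Rightarrow> real \<Rightarrow> bool" where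
  "assumption1 S Ct \<longleftrightarrow> 0 < Ct \<and>
     (\<forall>i\<in>{1..nsub S}.
        pos_def_form_on (Vh_sub S i) (sform S i) \<and> nonneg_form_on (s_dom S i) (sform S i) \<and>
        (\<forall>u\<in>s_dom S i. \<forall>u'\<in>s_dom S i. \<forall>v\<in>s_dom S i.
           ae_eq_on (closure (sub S i)) u u' \<longrightarrow> sform S i u v = sform S i u' v) \<and>
        (\<forall>j\<in>ovl_idx S i. \<forall>u\<in>Vh S.
           qf (a_sub S i) (\<lambda>x. of_real (pou S j x) * u x)
             \<le> Ct * (qf (a_sub S i) u + qf (sform S i) u)) \<and>
        (\<forall>\<eta>\<in>Linf_on (closure (sub S i)). \<forall>u\<in>Vh_sub S i.
           sqrt (qf (sform S i) (\<eta> * u))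
             \<le> real_of_ereal (Linf_norm (closure (sub S i)) \<eta>) * sqrt (qf (sform S i) u)))"

definition assumption2 :: "'p::euclidean_space schwarz \<Rightarrow> real \<Rightarrow> real \<Rightarrow> bool" where
  "assumption2 S CIa CIs \<longleftrightarrow>
     (\<forall>u\<in>L2_on (Omega S). interp S u \<in> Vh S) \<and>
     (\<forall>u\<in>L2_on (Omega S). \<forall>v\<in>L2_on (Omega S). interp S (u + v) = interp S u + interp S v) \<and>
     (\<forall>c. \<forall>u\<in>L2_on (Omega S). interp S (cscale c u) = cscale c (interp S u)) \<and>
     (\<forall>u\<in>L2_on (Omega S). \<forall>v\<in>L2_on (Omega S).
        ae_eq_on (Omega S) u v \<longrightarrow> interp S u = interp S v) \<and>
     (\<forall>v\<in>Vh S. interp S v = v) \<and>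
     (\<forall>i\<in>{1..nsub S}. \<forall>v\<in>Vh S. interp S (\<lambda>x. of_real (pou S i x) * v x) \<in> Vh_ovl S i) \<and>
     (\<forall>u\<in>V_space S \<union> cutoff_products S.
        (\<forall>\<tau>\<in>mesh S. qf (aform S \<tau>) (interp S u) \<le> CIa * qf (aform S \<tau>) u) \<and>
        (\<Sum>l\<in>{1..nsub S}. qf (sform S l) (interp S u))
          \<le> CIs * (\<Sum>l\<in>{1..nsub S}. qf (sform S l) u))"

definition n_sub :: "'p::topological_space schwarz \<Rightarrow> nat \<Rightarrow> nat" where
  "n_sub S i = cfun.dim (Vh_sub S i)"

definition eigenproblems :: "'p::topological_space schwarz \<Rightarrow> bool" where
  "eigenproblems S \<longleftrightarrow>
     (\<forall>i\<in>{1..nsub S}. \<forall>j\<in>{1..n_sub S i}.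
        eigfun S i j \<in> Vh_sub S i \<and> 0 < eigval S i j \<and>
        (\<forall>w\<in>Vh_sub S i. sform S i (eigfun S i j) w = of_real (eigval S i j) * a_sub S i (eigfun S i j) w) \<and>
        (\<forall>l\<in>{1..n_sub S i}.
           (j \<le> l \<longrightarrow> eigval S i l \<le> eigval S i j) \<and>
           sform S i (eigfun S i j) (eigfun S i l) = (if j = l then 1 else 0) \<and>
           (j \<noteq> l \<longrightarrow> a_sub S i (eigfun S i j) (eigfun S i l) = 0)))"

definition l_sub :: "'p::topological_space schwarz \<Rightarrow> real \<Rightarrow> nat \<Rightarrow> nat" where
  "l_sub S \<Lambda> i = card {j\<in>{1..n_sub S i}. \<Lambda> \<le> eigval S i j}"

definition V_aux :: "'p::topological_space schwarz \<Rightarrow> real \<Rightarrow> nat \<Rightarrow> 'p cfun set" where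
  "V_aux S \<Lambda> i = cfun.span (eigfun S i ` {1..l_sub S \<Lambda> i})"

definition proj_aux :: "'p::topological_space schwarz \<Rightarrow> real \<Rightarrow> nat \<Rightarrow> 'p cfun \<Rightarrow> 'p cfun" where
  "proj_aux S \<Lambda> i v = riesz (sform S i) (V_aux S \<Lambda> i) (\<lambda>w. sform S i v w)"

definition V_tilde :: "'p::topological_space schwarz \<Rightarrow> real \<Rightarrow> 'p cfun set" where
  "V_tilde S \<Lambda> = {v\<in>Vh S. \<forall>i\<in>{1..nsub S}. \<forall>w\<in>V_aux S \<Lambda> i. sform S i v w = 0}"

definition V_zero :: "'p::topological_space schwarz \<Rightarrow> real \<Rightarrow> 'p cfun set" where
  "V_zero S \<Lambda> = {u\<in>Vh S. \<forall>v\<in>V_tilde S \<Lambda>. a_full S u v = 0}"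

text \<open>\<open>c\<close> is the constant hidden in the relation \<open>\<lesssim>\<close>.\<close>

definition assumption3 :: "'p::topological_space schwarz \<Rightarrow> real \<Rightarrow> real \<Rightarrow> real \<Rightarrow> bool" where
  "assumption3 S \<Lambda> Cp c \<longleftrightarrow> 0 < Cp \<and> 0 < c \<and>
     (\<forall>u\<in>V_zero S \<Lambda>.
        (\<Sum>l\<in>{1..nsub S}. qf (sform S l) (proj_aux S \<Lambda> l u)) \<le> c * (Cp * qf (a_full S) u))"

definition bform :: "'p::topological_space schwarz \<Rightarrow> real \<Rightarrow> 'p cfun \<Rightarrow> 'p cfun \<Rightarrow> complex" where
  "bform S \<Lambda> u v = a_full S u v +
     (\<Sum>l\<in>{1..nsub S}. sform S l (proj_aux S \<Lambda> l u) (proj_aux S \<Lambda> l v))"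

definition psi_bar :: "'p::topological_space schwarz \<Rightarrow> real \<Rightarrow> nat \<Rightarrow> nat \<Rightarrow> nat \<Rightarrow> 'p cfun" where
  "psi_bar S \<Lambda> k i j =
     riesz (bform S \<Lambda>) (Vh_supp S (layer_region S k i))
       (\<lambda>v. sform S i (eigfun S i j) (proj_aux S \<Lambda> i v))"

definition V_coarse :: "'p::topological_space schwarz \<Rightarrow> real \<Rightarrow> nat \<Rightarrow> 'p cfun set" where
  "V_coarse S \<Lambda> k =
     cfun.span {psi_bar S \<Lambda> k i j | i j. i \<in> {1..nsub S} \<and> j \<in> {1..l_sub S \<Lambda> i}}"

definition A_h :: "'p::topological_space schwarz \<Rightarrow> 'p cfun \<Rightarrow> 'p cfun" where
  "A_h S = form_op (Vh_ip S) (a_full S) (Vh S)"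

definition A_loc :: "'p::topological_space schwarz \<Rightarrow> nat \<Rightarrow> 'p cfun \<Rightarrow> 'p cfun" where
  "A_loc S j = form_op (Vh_ip S) (aform S (closure (ovl S j))) (Vh_ovl S j)"

definition A_coarse :: "'p::topological_space schwarz \<Rightarrow> real \<Rightarrow> nat \<Rightarrow> 'p cfun \<Rightarrow> 'p cfun" where
  "A_coarse S \<Lambda> k = form_op (Vh_ip S) (a_full S) (V_coarse S \<Lambda> k)"

definition B_inv :: "'p::topological_space schwarz \<Rightarrow> real \<Rightarrow> nat \<Rightarrow> 'p cfun \<Rightarrow> 'p cfun" where
  "B_inv S \<Lambda> k u =
     (\<Sum>j\<in>{1..nsub S}. inv_into (Vh_ovl S j) (A_loc S j) (incl_adj (Vh_ip S) (Vh_ovl S j) u)) +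
     inv_into (V_coarse S \<Lambda> k) (A_coarse S \<Lambda> k) (incl_adj (Vh_ip S) (V_coarse S \<Lambda> k) u)"

end

theory Submission
  imports Defs
begin

text \<open>In the abstract additive Schwarz theory the eigenvalues of the preconditioned operator are
  bounded above by \<open>M + 1\<close>, since each local space interacts with at most \<open>M\<close> others, and below
  by \<open>1 / C\<close> for any stable decomposition with constant \<open>C\<close>. Under Assumption 3 the
  decomposition \<open>u = \<Sum>\<^sub>j I_h (\<theta>\<^sub>j u)\<close> with zero coarse component is already stable: the
  low-eigenvalue part of \<open>s\<^sub>i(u, u)\<close> is at most \<open>\<Lambda> a\<^sub>i(u, u)\<close>, while the part in the auxiliary
  space depends only on the \<open>a\<close>-orthogonal projection of \<open>u\<close> to \<open>V_zero\<close> and is bounded by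
  \<open>c C\<^sub>p a(u, u)\<close>. The coarse space thus enters only as some subspace of \<open>V_h\<close>.\<close>

section \<open>Hermitian forms and Riesz representation\<close>

text \<open>\<open>cond_number\<close> sees only eigenvalues, so everything is done for one
  eigenpair at a time: pairing the eigen-equation with \<open>u\<close> in the energy form turns
  each subspace term into the energy of a projection, and weighted Young inequalities bound the
  total from both sides. The main obstacle is that every operator is a definite description or an
  \<open>inv_into\<close>. Finite-dimensional Riesz representation is what makes them denote, and
  for the coarse basis this rests on the positivity of \<open>bform\<close>. A second obstacle is
  that restrictions, cutoff products and elements of \<open>Vh S\<close> can be compared only almost
  everywhere, hence the work on null overlaps of mesh elements. The number M enters the final bound
  twice: through interacting local spaces in the upper estimate, and through the cutoffs that reach
  one subdomain in the lower one.\<close>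

lemma sum_cfun_apply: "(\<Sum>j\<in>J. f j) x = (\<Sum>j\<in>J. f j x)" for f :: "'i \<Rightarrow> 'p cfun"
  by (induction J rule: infinite_finite_induct) auto

locale herm_form =
  fixes W :: "'p cfun set" and B :: "'p cfun \<Rightarrow> 'p cfun \<Rightarrow> complex"
  assumes subspace: "cfun.subspace W" and hermitian: "hermitian_form_on W B"
begin

lemma mem [simp, intro]:
  "0 \<in> W" "u \<in> W \<Longrightarrow> v \<in> W \<Longrightarrow> u + v \<in> W" "u \<in> W \<Longrightarrow> v \<in> W \<Longrightarrow> u - v \<in> W"
  "u \<in> W \<Longrightarrow> cscale c u \<in> W"
  using subspace by (auto intro: cfun.subspace_0 cfun.subspace_add cfun.subspace_diff cfun.subspace_scale)

lemma mem_sum: "(\<And>j. j \<in> J \<Longrightarrow> f j \<in> W) \<Longrightarrow> sum f J \<in> W"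
  using subspace by (rule cfun.subspace_sum)

lemma cnj: "u \<in> W \<Longrightarrow> v \<in> W \<Longrightarrow> B v u = cnj (B u v)"
  using hermitian unfolding hermitian_form_on_def by blast

lemma add_left: "u \<in> W \<Longrightarrow> v \<in> W \<Longrightarrow> w \<in> W \<Longrightarrow> B (u + v) w = B u w + B v w"
  and scale_left: "u \<in> W \<Longrightarrow> w \<in> W \<Longrightarrow> B (cscale c u) w = c * B u w"
  using hermitian unfolding hermitian_form_on_def by blast+

lemma add_right: "u \<in> W \<Longrightarrow> v \<in> W \<Longrightarrow> w \<in> W \<Longrightarrow> B u (v + w) = B u v + B u w"
  by (metis add_left cnj complex_cnj_add mem(2))

lemma scale_right: "u \<in> W \<Longrightarrow> v \<in> W \<Longrightarrow> B u (cscale c v) = Complex.cnj c * B u v"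
  by (metis scale_left cnj complex_cnj_mult mem(4))

lemma zero_left [simp]: "u \<in> W \<Longrightarrow> B 0 u = 0"
  using add_left[of 0 0 u] by simp

lemma zero_right [simp]: "u \<in> W \<Longrightarrow> B u 0 = 0"
  using add_right[of u 0 0] by simp

lemma diff_left: "u \<in> W \<Longrightarrow> v \<in> W \<Longrightarrow> w \<in> W \<Longrightarrow> B (u - v) w = B u w - B v w"
  using add_left[of "u - v" v w] by simp

lemma diff_right: "u \<in> W \<Longrightarrow> v \<in> W \<Longrightarrow> w \<in> W \<Longrightarrow> B u (v - w) = B u v - B u w"
  using add_right[of u "v - w" w] by simp

lemma sum_left: "(\<And>j. j \<in> J \<Longrightarrow> f j \<in> W) \<Longrightarrow> w \<in> W \<Longrightarrow> B (sum f J) w = (\<Sum>j\<in>J. B (f j) w)"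
  by (induction J rule: infinite_finite_induct) (auto simp: add_left mem_sum)

lemma sum_right: "(\<And>j. j \<in> J \<Longrightarrow> f j \<in> W) \<Longrightarrow> w \<in> W \<Longrightarrow> B w (sum f J) = (\<Sum>j\<in>J. B w (f j))"
  by (induction J rule: infinite_finite_induct) (auto simp: add_right mem_sum)

lemma diag: "u \<in> W \<Longrightarrow> B u u = of_real (qf B u)"
  using cnj[of u u] by (simp add: qf_def complex_eq_iff)

lemma herm_form_subset: "cfun.subspace X \<Longrightarrow> X \<subseteq> W \<Longrightarrow> herm_form X B"
  using hermitian unfolding herm_form_def hermitian_form_on_def by blast

lemma orthogonal_sum:
  assumes J: "finite J" and f: "\<And>j. j \<in> J \<Longrightarrow> f j \<in> W"
    and orth: "\<And>j l. j \<in> J \<Longrightarrow> l \<in> J \<Longrightarrow> j \<noteq> l \<Longrightarrow> B (f j) (f l) = 0"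
  shows "B (\<Sum>j\<in>J. cscale (c j) (f j)) (\<Sum>j\<in>J. cscale (d j) (f j))
    = (\<Sum>j\<in>J. c j * Complex.cnj (d j) * B (f j) (f j))"
proof -
  have mem': "cscale (x j) (f j) \<in> W" if "j \<in> J" for j x using f that by auto
  have "B (\<Sum>j\<in>J. cscale (c j) (f j)) (\<Sum>j\<in>J. cscale (d j) (f j))
      = (\<Sum>j\<in>J. \<Sum>l\<in>J. B (cscale (c j) (f j)) (cscale (d l) (f l)))"
    by (subst sum_left) (auto simp: mem' mem_sum sum_right)
  also have "\<dots> = (\<Sum>j\<in>J. \<Sum>l\<in>J. if l = j then c j * Complex.cnj (d j) * B (f j) (f j) else 0)"
    by (intro sum.cong refl) (auto simp: scale_left scale_right f orth)
  also have "\<dots> = (\<Sum>j\<in>J. c j * Complex.cnj (d j) * B (f j) (f j))"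
    using J by (intro sum.cong refl) simp
  finally show ?thesis .
qed

text \<open>Applied to both \<open>sform S i\<close> and \<open>a_sub S i\<close>, which the
  eigenfunctions diagonalise simultaneously.\<close>

lemma qf_orthogonal_sum:
  assumes J: "finite J" and f: "\<And>j. j \<in> J \<Longrightarrow> f j \<in> W"
    and orth: "\<And>j l. j \<in> J \<Longrightarrow> l \<in> J \<Longrightarrow> j \<noteq> l \<Longrightarrow> B (f j) (f l) = 0"
  shows "qf B (\<Sum>j\<in>J. cscale (c j) (f j)) = (\<Sum>j\<in>J. (cmod (c j))\<^sup>2 * qf B (f j))"
proof -
  have "B (\<Sum>j\<in>J. cscale (c j) (f j)) (\<Sum>j\<in>J. cscale (c j) (f j))
      = (\<Sum>j\<in>J. c j * Complex.cnj (c j) * B (f j) (f j))"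
    using assms by (rule orthogonal_sum)
  also have "\<dots> = (\<Sum>j\<in>J. of_real ((cmod (c j))\<^sup>2 * qf B (f j)))"
    using J by (intro sum.cong refl) (simp add: diag f flip: complex_norm_square)
  finally show ?thesis by (simp add: qf_def)
qed

text \<open>Lets orthogonality to a generating family pass to its span by
  \<open>cfun.span_minimal\<close>.\<close>

lemma subspace_annihilator:
  assumes "x \<in> W"
  shows "cfun.subspace {w\<in>W. B x w = 0}" "cfun.subspace {w\<in>W. B w x = 0}"
  using assms
  by (auto intro!: cfun.subspaceI simp del: plus_fun_apply simp: add_right scale_right add_left scale_left)

end

locale nonneg_form = herm_form +
  assumes nonneg: "u \<in> W \<Longrightarrow> 0 \<le> qf B u"
begin

lemma qf_diff:
  "u \<in> W \<Longrightarrow> v \<in> W \<Longrightarrow> qf B (u - v) = qf B u + qf B v - 2 * Re (B u v)"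
  using cnj[of u v] by (simp add: qf_def diff_left diff_right)

lemma qf_add:
  "u \<in> W \<Longrightarrow> v \<in> W \<Longrightarrow> qf B (u + v) = qf B u + qf B v + 2 * Re (B u v)"
  using cnj[of u v] by (simp add: qf_def add_left add_right)

lemma qf_cscale: "u \<in> W \<Longrightarrow> qf B (cscale (of_real t) u) = t\<^sup>2 * qf B u"
  by (simp add: qf_def scale_left scale_right power2_eq_square)

text \<open>Expand the nonnegative energy of \<open>t u - v\<close> and divide by \<open>t\<close>.
  The free weight stands in for Cauchy-Schwarz and avoids square roots; the Schwarz estimates use
  the weights 1, 1/M and 1/C.\<close>

lemma young:
  assumes "u \<in> W" "v \<in> W" "0 < t"
  shows "2 * Re (B u v) \<le> t * qf B u + qf B v / t"
proof -
  have "0 \<le> qf B (cscale (of_real t) u - v)" using assms by (auto intro: nonneg)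
  also have "\<dots> = t\<^sup>2 * qf B u + qf B v - 2 * t * Re (B u v)"
    using assms by (simp add: qf_diff qf_cscale scale_left)
  finally have "2 * Re (B u v) * t \<le> (t * qf B u + qf B v / t) * t"
    using assms(3) by (simp only: distrib_right) (simp add: power2_eq_square mult_ac)
  then show ?thesis using assms(3) by (simp only: mult_le_cancel_right_pos)
qed

text \<open>A bounded number of interactions replaces the orthogonality in Pythagoras' theorem.\<close>

lemma qf_sum_le:
  assumes J: "finite J" and u: "\<And>j. j \<in> J \<Longrightarrow> u j \<in> W"
    and sub: "\<And>j. j \<in> J \<Longrightarrow> N j \<subseteq> J" and card: "\<And>j. j \<in> J \<Longrightarrow> card (N j) \<le> M"
    and sym: "\<And>j l. j \<in> J \<Longrightarrow> l \<in> J \<Longrightarrow> l \<in> N j \<longleftrightarrow> j \<in> N l"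
    and orth: "\<And>j l. j \<in> J \<Longrightarrow> l \<in> J \<Longrightarrow> l \<notin> N j \<Longrightarrow> B (u j) (u l) = 0"
  shows "qf B (sum u J) \<le> real M * (\<Sum>j\<in>J. qf B (u j))"
proof -
  let ?q = "\<lambda>j. qf B (u j)"
  let ?n = "\<lambda>j l. if l \<in> N j then 1 else 0 :: real"
  have n: "(\<Sum>l\<in>J. ?n j l) \<le> real M" if "j \<in> J" for j
    using card[OF that] sub[OF that] J by (simp add: sum.If_cases Int_absorb1)
  have "qf B (sum u J) = (\<Sum>j\<in>J. \<Sum>l\<in>J. Re (B (u j) (u l)))"
    unfolding qf_def by (subst sum_left) (auto simp: u mem_sum sum_right)
  \<comment> \<open>Each surviving cross term is split evenly between its two indices; by the
    symmetry of \<open>N\<close> the two halves have equal sums, so each energy is finally counted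
    once per neighbour.\<close>
  also have "\<dots> \<le> (\<Sum>j\<in>J. \<Sum>l\<in>J. (?n j l * ?q j + ?n l j * ?q l) / 2)"
  proof (intro sum_mono)
    fix j l assume jl: "j \<in> J" "l \<in> J"
    show "Re (B (u j) (u l)) \<le> (?n j l * ?q j + ?n l j * ?q l) / 2"
      using young[of "u j" "u l" 1] orth[OF jl] sym[OF jl] u jl by auto
  qed
  also have "\<dots> = (\<Sum>j\<in>J. \<Sum>l\<in>J. ?n j l * ?q j) / 2 + (\<Sum>j\<in>J. \<Sum>l\<in>J. ?n l j * ?q l) / 2"
    by (simp only: sum.distrib add_divide_distrib sum_divide_distrib)
  also have "(\<Sum>j\<in>J. \<Sum>l\<in>J. ?n l j * ?q l) = (\<Sum>j\<in>J. \<Sum>l\<in>J. ?n j l * ?q j)"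
    by (rule sum.swap)
  also have "(\<Sum>j\<in>J. \<Sum>l\<in>J. ?n j l * ?q j) / 2 + (\<Sum>j\<in>J. \<Sum>l\<in>J. ?n j l * ?q j) / 2
      = (\<Sum>j\<in>J. (\<Sum>l\<in>J. ?n j l) * ?q j)"
    by (simp only: sum_distrib_right field_sum_of_halves)
  also have "\<dots> \<le> (\<Sum>j\<in>J. real M * ?q j)"
    using n nonneg u by (intro sum_mono mult_right_mono) auto
  finally show ?thesis by (simp add: sum_distrib_left)
qed

end

section \<open>Riesz representation on finite-dimensional spaces\<close>

definition fin_dim :: "'p cfun set \<Rightarrow> bool" where
  "fin_dim W \<longleftrightarrow> (\<exists>B. finite B \<and> W = cfun.span B)"

lemma fin_dim_subspace:
  assumes V: "fin_dim V" and W: "cfun.subspace W" "W \<subseteq> V"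
  shows "fin_dim W"
proof -
  obtain T where T: "finite T" "V = cfun.span T" using V unfolding fin_dim_def by auto
  obtain B where B: "B \<subseteq> W" "cfun.independent B" "W \<subseteq> cfun.span B"
    by (rule cfun.basis_exists[of W])
  have "B \<subseteq> cfun.span T" using B(1) W(2) unfolding T(2) by (rule subset_trans)
  then have "finite B" using cfun.independent_span_bound[OF T(1) B(2)] by simp
  moreover have "cfun.span B = W"
    using cfun.span_minimal[OF B(1) W(1)] B(3) by (rule subset_antisym)
  ultimately show ?thesis unfolding fin_dim_def by metis
qed

locale pos_form = herm_form +
  assumes pos: "u \<in> W \<Longrightarrow> u \<noteq> 0 \<Longrightarrow> 0 < qf B u"
begin

sublocale nonneg_form
proof
  fix u assume "u \<in> W"
  then show "0 \<le> qf B u" using pos[of u] by (cases "u = 0") (auto simp: qf_def)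
qed

lemma eq_0: "u \<in> W \<Longrightarrow> qf B u = 0 \<Longrightarrow> u = 0"
  using pos by force

lemma pos_form_subset: "cfun.subspace X \<Longrightarrow> X \<subseteq> W \<Longrightarrow> pos_form X B"
  by (intro pos_form.intro pos_form_axioms.intro) (auto intro: herm_form_subset pos)

lemma riesz_unique:
  assumes "w \<in> W" "w' \<in> W" "\<And>v. v \<in> W \<Longrightarrow> B w v = B w' v"
  shows "w = w'"
proof -
  have "B (w - w') (w - w') = 0"
    using assms by (simp only: diff_left mem diff_self)
  then show ?thesis using eq_0[of "w - w'"] assms by (auto simp: qf_def)
qed

end

definition conj_linear_on :: "'p cfun set \<Rightarrow> ('p cfun \<Rightarrow> complex) \<Rightarrow> bool" where
  "conj_linear_on W f \<longleftrightarrow>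
     (\<forall>u\<in>W. \<forall>v\<in>W. f (u + v) = f u + f v) \<and> (\<forall>c. \<forall>u\<in>W. f (cscale c u) = cnj c * f u)"

lemma (in herm_form) conj_linear_on_form:
  "u \<in> W \<Longrightarrow> X \<subseteq> W \<Longrightarrow> conj_linear_on X (B u)"
  unfolding conj_linear_on_def by (auto simp: subset_iff add_right scale_right)

lemma conj_linear_on_subset: "conj_linear_on W f \<Longrightarrow> X \<subseteq> W \<Longrightarrow> conj_linear_on X f"
  unfolding conj_linear_on_def by blast

lemma conj_linear_on_add: "conj_linear_on W f \<Longrightarrow> u \<in> W \<Longrightarrow> v \<in> W \<Longrightarrow> f (u + v) = f u + f v"
  and conj_linear_on_scale: "conj_linear_on W f \<Longrightarrow> u \<in> W \<Longrightarrow> f (cscale c u) = cnj c * f u"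
  by (simp_all add: conj_linear_on_def)

lemma conj_linear_on_zero:
  assumes "conj_linear_on W f" "0 \<in> W"
  shows "f 0 = 0"
proof -
  have "f (0 + 0) = f 0 + f 0" using assms by (intro conj_linear_on_add)
  then show ?thesis by simp
qed

text \<open>Gram-Schmidt on the generators. The induction hypothesis is used twice, for the
  functional \<open>B b\<close>, which yields the projection \<open>p\<close> of the new generator,
  and for \<open>f\<close> itself; the residual \<open>e = b - p\<close> then supplies the one
  missing direction.\<close>

lemma pos_form_span_represent:
  assumes "finite T" "pos_form (cfun.span T) B" "conj_linear_on (cfun.span T) f"
  shows "\<exists>w\<in>cfun.span T. \<forall>v\<in>cfun.span T. B w v = f v"
  using assms
proof (induction T arbitrary: f rule: finite_induct)
  case empty
  interpret pos_form "cfun.span {}" B by (rule empty.prems(1))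
  have "f 0 = 0" using empty.prems(2) mem(1) by (rule conj_linear_on_zero)
  then have "B 0 v = f v" if "v \<in> cfun.span {}" for v
    using that zero_left[OF mem(1)] by (simp only: cfun.span_empty singleton_iff)
  then show ?case using mem(1) by (intro bexI ballI)
next
  case (insert b T)
  let ?V = "cfun.span (insert b T)" and ?W = "cfun.span T"
  interpret pos_form ?V B by (rule insert.prems)
  have sub: "?W \<subseteq> ?V" by (rule cfun.span_mono) (rule subset_insertI)
  interpret W: pos_form ?W B by (rule pos_form_subset[OF cfun.subspace_span sub])
  have b: "b \<in> ?V" by (simp add: cfun.span_base)
  obtain p where p: "p \<in> ?W" "\<And>v. v \<in> ?W \<Longrightarrow> B p v = B b v"
    using insert.IH[OF W.pos_form_axioms conj_linear_on_form[OF b sub]] by blast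
  obtain q where q: "q \<in> ?W" "\<And>v. v \<in> ?W \<Longrightarrow> B q v = f v"
    using insert.IH[OF W.pos_form_axioms conj_linear_on_subset[OF insert.prems(2) sub]] by blast
  define e where "e = b - p"
  have e: "e \<in> ?V" unfolding e_def using b subsetD[OF sub p(1)] by (rule mem(3))
  have orth: "B e v = 0" "B v e = 0" if "v \<in> ?W" for v
  proof -
    have v: "v \<in> ?V" using sub that by (rule subsetD)
    show "B e v = 0"
      using p(2)[OF that] b subsetD[OF sub p(1)] v by (simp add: e_def diff_left)
    then show "B v e = 0" using cnj[OF e v] by simp
  qed
  \<comment> \<open>If \<open>b\<close> already lies in the old span, then \<open>e\<close> is 0 and
    the quotient is the default value 0, which is harmless because \<open>f 0\<close> is 0
    too.\<close>
  define w where "w = q + cscale (f e / B e e) e"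
  have qV: "q \<in> ?V" using sub q(1) by (rule subsetD)
  have w: "w \<in> ?V" unfolding w_def using qV mem(4)[OF e] by (rule mem(2))
  have Be: "B w e = f e"
  proof (cases "e = 0")
    case True
    have "f e = 0" unfolding True using insert.prems(2) mem(1) by (rule conj_linear_on_zero)
    then show ?thesis using True w by simp
  next
    case False
    then have "B e e \<noteq> 0" using pos[OF e] by (auto simp: qf_def)
    then show ?thesis using qV e orth(2)[OF q(1)] by (simp add: w_def add_left scale_left)
  qed
  have "B w v = f v" if v: "v \<in> ?V" for v
  proof -
    obtain k where k: "v - cscale k b \<in> ?W" using v unfolding cfun.span_breakdown_eq by (rule exE)
    \<comment> \<open>Rewriting \<open>b\<close> as \<open>e + p\<close> moves the multiple of
      \<open>p\<close> into the old span, so that \<open>v\<close> splits orthogonally into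
      \<open>y\<close> and a multiple of \<open>e\<close>.\<close>
    define y where "y = (v - cscale k b) + cscale k p"
    have y: "y \<in> ?W" unfolding y_def using k W.mem(4)[OF p(1)] by (rule W.mem(2))
    have yV: "y \<in> ?V" using sub y by (rule subsetD)
    have v_eq: "v = y + cscale k e"
      unfolding y_def e_def by (auto simp: cscale_def fun_eq_iff algebra_simps)
    have "B w y = f y"
      using qV yV e q(2)[OF y] orth(1)[OF y] by (simp add: w_def add_left scale_left)
    then have "B w v = f y + cnj k * f e"
      using w yV e Be by (subst v_eq) (simp add: add_right scale_right)
    also have "\<dots> = f v"
    proof -
      have "f (y + cscale k e) = f y + f (cscale k e)" "f (cscale k e) = cnj k * f e"
        by (rule conj_linear_on_add[OF insert.prems(2) yV mem(4)[OF e]],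
            rule conj_linear_on_scale[OF insert.prems(2) e])
      then show ?thesis unfolding v_eq by simp
    qed
    finally show ?thesis .
  qed
  then show ?case using w by (intro bexI ballI)
qed

text \<open>Existence comes from the spanning set and uniqueness from definiteness, so the
  description in \<open>riesz\<close> denotes.\<close>

lemma riesz:
  assumes "pos_form W B" "fin_dim W" "conj_linear_on W f"
  shows riesz_mem: "riesz B W f \<in> W"
    and riesz_eq: "v \<in> W \<Longrightarrow> B (riesz B W f) v = f v"
proof -
  interpret pos_form W B by fact
  have ex: "\<exists>w\<in>W. \<forall>v\<in>W. B w v = f v"
    using assms pos_form_span_represent unfolding fin_dim_def by metis
  have "\<exists>!w. w \<in> W \<and> (\<forall>v\<in>W. B w v = f v)"
  proof (rule ex_ex1I)
    fix w w' assume "w \<in> W \<and> (\<forall>v\<in>W. B w v = f v)" "w' \<in> W \<and> (\<forall>v\<in>W. B w' v = f v)"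
    then show "w = w'" by (intro riesz_unique) auto
  qed (use ex in blast)
  from theI'[OF this] show "riesz B W f \<in> W" "v \<in> W \<Longrightarrow> B (riesz B W f) v = f v"
    unfolding riesz_def by auto
qed

context pos_form
begin

lemma orthogonal_independent:
  assumes X: "X \<subseteq> W" "0 \<notin> X" and orth: "\<And>x y. x \<in> X \<Longrightarrow> y \<in> X \<Longrightarrow> x \<noteq> y \<Longrightarrow> B x y = 0"
  shows "cfun.independent X"
proof
  assume "cfun.dependent X"
  then obtain x where x: "x \<in> X" "x \<in> cfun.span (X - {x})"
    unfolding cfun.dependent_def by (elim bexE)
  have xW: "x \<in> W" using X(1) x(1) by (rule subsetD)
  have "X - {x} \<subseteq> {w\<in>W. B w x = 0}" using X(1) x(1) orth by auto
  then have "cfun.span (X - {x}) \<subseteq> {w\<in>W. B w x = 0}"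
    using subspace_annihilator(2)[OF xW] by (rule cfun.span_minimal)
  then have "B x x = 0" using x(2) by auto
  then have "x = 0" using eq_0[OF xW] by (simp add: qf_def)
  then show False using x(1) X(2) by simp
qed

text \<open>Completeness by counting: a nonzero residual would be orthogonal to every
  \<open>f j\<close>, and adjoining it would give more independent vectors than the dimension
  allows.\<close>

lemma orthonormal_expansion:
  assumes W: "fin_dim W" and J: "finite J" "card J = cfun.dim W"
    and f: "\<And>j. j \<in> J \<Longrightarrow> f j \<in> W"
    and orth: "\<And>j l. j \<in> J \<Longrightarrow> l \<in> J \<Longrightarrow> B (f j) (f l) = (if j = l then 1 else 0)"
    and u: "u \<in> W"
  shows "u = (\<Sum>j\<in>J. cscale (B u (f j)) (f j))"
proof (rule ccontr)
  assume neq: "u \<noteq> (\<Sum>j\<in>J. cscale (B u (f j)) (f j))"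
  define p where "p = (\<Sum>j\<in>J. cscale (B u (f j)) (f j))"
  define e where "e = u - p"
  have p: "p \<in> W" unfolding p_def using f by (intro mem_sum mem)
  have e: "e \<in> W" "e \<noteq> 0" using u p neq by (auto simp: e_def p_def[symmetric])
  have ef: "B e (f l) = 0" if l: "l \<in> J" for l
  proof -
    have "B p (f l) = (\<Sum>j\<in>J. B (cscale (B u (f j)) (f j)) (f l))"
      unfolding p_def using f l by (intro sum_left) auto
    also have "\<dots> = (\<Sum>j\<in>J. if j = l then B u (f l) else 0)"
      using f l orth by (intro sum.cong refl) (auto simp: scale_left)
    also have "\<dots> = B u (f l)" using J l by simp
    finally show ?thesis using u p f l by (simp add: e_def diff_left)
  qed
  have inj: "inj_on f J" using orth by (intro inj_onI) (metis zero_neq_one)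
  have 1: "B (f j) (f j) = 1" if "j \<in> J" for j using orth[OF that that] by simp
  have eJ: "e \<notin> f ` J"
  proof
    assume "e \<in> f ` J"
    then obtain j where "j \<in> J" "e = f j" by auto
    then show False using ef[of j] 1[of j] by simp
  qed
  have 0: "0 \<notin> f ` J"
  proof
    assume "0 \<in> f ` J"
    then obtain j where j: "j \<in> J" "f j = 0" by (auto simp del: zero_fun_apply)
    then show False using 1[OF j(1)] zero_left[OF mem(1)] unfolding j(2) by simp
  qed
  have "cfun.independent (insert e (f ` J))"
  proof (rule orthogonal_independent)
    fix x y assume "x \<in> insert e (f ` J)" "y \<in> insert e (f ` J)" "x \<noteq> y"
    then show "B x y = 0" using ef orth f cnj[OF e(1)] by auto
  qed (use e f 0 in auto)
  moreover obtain T where T: "T \<subseteq> W" "cfun.independent T" "W \<subseteq> cfun.span T" "card T = cfun.dim W"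
    by (rule cfun.basis_exists[of W])
  moreover have "finite T"
  proof -
    obtain T' where T': "finite T'" "W = cfun.span T'" using W unfolding fin_dim_def by (elim exE conjE)
    have "T \<subseteq> cfun.span T'" using T(1) unfolding T'(2) .
    then show ?thesis using cfun.independent_span_bound[OF T'(1) T(2)] by simp
  qed
  moreover have "insert e (f ` J) \<subseteq> cfun.span T"
    by (rule subset_trans[OF _ T(3)]) (use e(1) f in auto)
  ultimately have "card (insert e (f ` J)) \<le> cfun.dim W"
    using cfun.independent_span_bound[of T "insert e (f ` J)"] by simp
  then show False using J eJ by (simp add: card_image[OF inj])
qed

end

lemma riesz_eqI:
  assumes "pos_form W B" "w \<in> W" "\<And>v. v \<in> W \<Longrightarrow> B w v = f v"
  shows "riesz B W f = w"
  unfolding riesz_def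
proof (rule the_equality)
  fix w' assume w': "w' \<in> W \<and> (\<forall>v\<in>W. B w' v = f v)"
  then show "w' = w"
    by (intro pos_form.riesz_unique[OF assms(1)]) (use assms(2,3) in auto)
qed (use assms in auto)

lemma riesz_cong: "(\<And>v. v \<in> W \<Longrightarrow> f v = g v) \<Longrightarrow> riesz B W f = riesz B W g"
  unfolding riesz_def by (intro arg_cong[where f=The] ext) auto

text \<open>The inner product \<open>ip\<close> enters the global operator, the adjoint inclusion
  and the local operator, and cancels; what remains is the energy projection onto \<open>W\<close>.
  The separate \<open>a'\<close> admits local operators defined by a form on a region that agrees
  with \<open>a\<close> on \<open>W\<close>.\<close>

lemma subspace_solve:
  assumes ip: "pos_form V ip" and a: "pos_form V a" and V: "fin_dim V"
    and W: "cfun.subspace W" "W \<subseteq> V" and u: "u \<in> V"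
    and a': "\<And>w v. w \<in> W \<Longrightarrow> v \<in> W \<Longrightarrow> a' w v = a w v"
  defines "p \<equiv> inv_into W (form_op ip a' W) (incl_adj ip W (form_op ip a V u))"
  shows subspace_solve_mem: "p \<in> W" and subspace_solve_eq: "v \<in> W \<Longrightarrow> a p v = a u v"
proof -
  interpret ip: pos_form V ip by fact
  interpret a: pos_form V a by fact
  have ipW: "pos_form W ip" and aW: "pos_form W a" and finW: "fin_dim W"
    using ip.pos_form_subset a.pos_form_subset fin_dim_subspace[OF V] W by auto
  have Au: "form_op ip a V u \<in> V" "\<And>v. v \<in> V \<Longrightarrow> ip (form_op ip a V u) v = a u v"
    unfolding form_op_def using riesz[OF ip V a.conj_linear_on_form[OF u order_refl]] by auto
  define g where "g = incl_adj ip W (form_op ip a V u)"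
  have g: "ip g v = a u v" if "v \<in> W" for v
    unfolding g_def incl_adj_def
    using riesz_eq[OF ipW finW ip.conj_linear_on_form[OF Au(1) W(2)] that] Au(2) that W by auto
  have loc: "ip (form_op ip a' W w) v = a w v" if "w \<in> W" "v \<in> W" for w v
  proof -
    have "form_op ip a' W w = riesz ip W (a w)"
      unfolding form_op_def using a' that by (intro riesz_cong) auto
    moreover have "conj_linear_on W (a w)"
      using a.conj_linear_on_form that W by auto
    ultimately show ?thesis using riesz_eq[OF ipW finW] that by auto
  qed
  \<comment> \<open>The energy projection of \<open>u\<close> shows that \<open>g\<close> is in the
    range of the local operator, so \<open>inv_into\<close> returns a true preimage; by
    \<open>loc\<close> any preimage satisfies the claimed equation.\<close>
  define p0 where "p0 = riesz a W (a u)"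
  have p0: "p0 \<in> W" "\<And>v. v \<in> W \<Longrightarrow> a p0 v = a u v"
    unfolding p0_def using riesz[OF aW finW a.conj_linear_on_form[OF u W(2)]] by auto
  have "form_op ip a' W p0 = g"
    unfolding g_def incl_adj_def form_op_def[of _ a']
    by (rule riesz_cong) (use Au(2) W(2) a' p0 in auto)
  then have "g \<in> form_op ip a' W ` W" using p0 by auto
  then have "p \<in> W" "form_op ip a' W p = g"
    unfolding p_def g_def by (simp_all only: inv_into_into f_inv_into_f)
  then show "p \<in> W" "v \<in> W \<Longrightarrow> a p v = a u v" using loc[of p v] g[of v] by simp_all
qed

section \<open>Additive Schwarz operators\<close>

text \<open>The eigenvalue bounds of the abstract theory of additive Schwarz methods, for a stable
  decomposition whose coarse component is \<open>0\<close>.\<close>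

lemma additive_schwarz_eigenvalue:
  assumes a: "pos_form V a" and J: "finite J" and M: "0 < M" and C: "0 < C"
    and u: "u \<in> V" "u \<noteq> 0"
    and W: "\<And>j. j \<in> J \<Longrightarrow> W j \<subseteq> V" "W0 \<subseteq> V"
    and P: "\<And>j. j \<in> J \<Longrightarrow> P j \<in> W j" "\<And>j v. j \<in> J \<Longrightarrow> v \<in> W j \<Longrightarrow> a (P j) v = a u v"
    and P0: "P0 \<in> W0" "\<And>v. v \<in> W0 \<Longrightarrow> a P0 v = a u v"
    and N: "\<And>j. j \<in> J \<Longrightarrow> N j \<subseteq> J" "\<And>j. j \<in> J \<Longrightarrow> card (N j) \<le> M"
      "\<And>j l. j \<in> J \<Longrightarrow> l \<in> J \<Longrightarrow> l \<in> N j \<longleftrightarrow> j \<in> N l"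
    and orth: "\<And>j l v w. j \<in> J \<Longrightarrow> l \<in> J \<Longrightarrow> l \<notin> N j \<Longrightarrow> v \<in> W j \<Longrightarrow> w \<in> W l \<Longrightarrow> a v w = 0"
    and d: "\<And>j. j \<in> J \<Longrightarrow> d j \<in> W j" "sum d J = u"
      "(\<Sum>j\<in>J. qf a (d j)) \<le> C * qf a u"
    and eig: "(\<Sum>j\<in>J. P j) + P0 = cscale \<mu> u"
  shows "cmod \<mu> \<le> real M + 1" "1 \<le> C * cmod \<mu>"
proof -
  interpret pos_form V a by fact
  have PV: "j \<in> J \<Longrightarrow> P j \<in> V" "P0 \<in> V" and dV: "j \<in> J \<Longrightarrow> d j \<in> V" for j
    using P(1) P0(1) W d(1) by blast+
  define q where "q = qf a u"
  define S where "S = (\<Sum>j\<in>J. qf a (P j))"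
  have q: "0 < q" using pos u by (auto simp: q_def)
  have Pu: "a (P j) u = of_real (qf a (P j))" if "j \<in> J" for j
    using P that cnj[OF u(1) PV(1)[OF that]] diag[OF PV(1)[OF that]] by (metis complex_cnj_complex_of_real)
  have P0u: "a P0 u = of_real (qf a P0)"
    using P0 cnj[OF u(1) PV(2)] diag[OF PV(2)] by (metis complex_cnj_complex_of_real)
  \<comment> \<open>Tested with \<open>u\<close>, each projection contributes its own energy. Hence
    \<open>\<mu>\<close> times \<open>q\<close> is real and nonnegative, and its modulus can be read
    off.\<close>
  have "\<mu> * of_real q = a ((\<Sum>j\<in>J. P j) + P0) u"
    unfolding eig using u by (simp add: scale_left diag q_def)
  also have "\<dots> = of_real (S + qf a P0)"
    using u PV by (simp add: add_left sum_left mem_sum Pu P0u S_def)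
  finally have mu: "\<mu> * of_real q = of_real (S + qf a P0)" .
  have S0: "0 \<le> S" "0 \<le> qf a P0" using PV nonneg by (auto simp: S_def intro: sum_nonneg)
  have "cmod \<mu> * q = cmod (\<mu> * of_real q)" using q by (simp add: norm_mult)
  then have muq: "cmod \<mu> * q = S + qf a P0"
    unfolding mu norm_of_real using S0 by simp
  \<comment> \<open>Since the left side is twice the energy of \<open>P0\<close>, this says that an
    energy projection does not increase energy.\<close>
  have "2 * Re (a P0 u) \<le> 1 * qf a P0 + qf a u / 1" by (intro young) (use u PV in auto)
  then have P0q: "qf a P0 \<le> q" by (simp add: P0u q_def)
  \<comment> \<open>With weight 1/M the factor M from \<open>qf_sum_le\<close> cancels:
    \<open>2 S \<le> S + M q\<close>.\<close>
  have "2 * Re (a (sum P J) u) \<le> (1 / M) * qf a (sum P J) + qf a u / (1 / M)"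
    by (intro young) (use u PV M in \<open>auto intro: mem_sum\<close>)
  moreover have "Re (a (sum P J) u) = S" using u PV by (simp add: sum_left Pu S_def)
  moreover have "qf a (sum P J) \<le> real M * S"
    unfolding S_def by (rule qf_sum_le[OF J PV(1) N orth]) (use P(1) in auto)
  then have "(1 / M) * qf a (sum P J) \<le> S" using M by (simp add: field_simps)
  ultimately have SM: "S \<le> M * q" by (simp add: q_def mult.commute)
  have "cmod \<mu> * q \<le> (real M + 1) * q" using muq SM P0q by (simp add: algebra_simps)
  then show "cmod \<mu> \<le> real M + 1" using q by simp
  \<comment> \<open>The lower bound: each \<open>u\<close> is replaced by \<open>P j\<close> against
    the component \<open>d j\<close>. Weight 1/C makes the components cost at most one
    \<open>q\<close> in total, leaving \<open>q \<le> C S\<close>, and \<open>S\<close> is at most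
    \<open>cmod \<mu> * q\<close>.\<close>
  have "2 * q = (\<Sum>j\<in>J. 2 * Re (a (d j) (P j)))"
  proof -
    have "a u u = (\<Sum>j\<in>J. a (d j) u)"
      using sum_left[of J d u] dV u d(2) by simp
    also have "\<dots> = (\<Sum>j\<in>J. a (d j) (P j))"
    proof (intro sum.cong refl)
      fix j assume j: "j \<in> J"
      show "a (d j) u = a (d j) (P j)"
        using P(2)[OF j d(1)[OF j]] cnj[OF u(1) dV[OF j]] cnj[OF PV(1)[OF j] dV[OF j]] by simp
    qed
    finally show ?thesis by (simp add: q_def qf_def sum_distrib_left)
  qed
  also have "\<dots> \<le> (\<Sum>j\<in>J. 1 / C * qf a (d j) + qf a (P j) / (1 / C))"
    using dV PV C by (intro sum_mono young) auto
  also have "\<dots> = (\<Sum>j\<in>J. qf a (d j)) / C + C * S"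
    by (simp add: sum.distrib sum_divide_distrib S_def sum_distrib_left mult.commute)
  also have "\<dots> \<le> q + C * (cmod \<mu> * q)"
    using d(3) C S0 muq by (intro add_mono mult_left_mono) (auto simp: field_simps q_def)
  finally have "1 * q \<le> (C * cmod \<mu>) * q" by simp
  then show "1 \<le> C * cmod \<mu>" using q by (simp only: mult_le_cancel_right_pos)
qed

lemma ennreal_inverse_antimono: "x \<le> y \<Longrightarrow> inverse y \<le> inverse x" for x y :: ennreal
  by (simp add: less_eq_ennreal.rep_eq inverse_ennreal.rep_eq ereal_inverse_antimono)

text \<open>The lower bound also excludes the eigenvalue 0, for which \<open>cond_number\<close>
  would be infinite.\<close>

lemma cond_number_le:
  assumes C: "0 < C" and bnd: "\<And>\<mu>. \<mu> \<in> eigenvalues_on W T \<Longrightarrow> cmod \<mu> \<le> K \<and> 1 \<le> C * cmod \<mu>"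
  shows "cond_number W T \<le> ennreal (K * C)"
proof (cases "eigenvalues_on W T = {}")
  \<comment> \<open>Here the supremum is 0 and the infimum is \<open>top\<close>, so the quotient is
    0 whatever the sign of \<open>K\<close>.\<close>
  case True
  then show ?thesis by (simp add: cond_number_def)
next
  case False
  then obtain \<nu> where "\<nu> \<in> eigenvalues_on W T" by auto
  then have K: "0 \<le> K" using bnd norm_ge_zero order_trans by blast
  have 0: "0 \<notin> eigenvalues_on W T" using bnd[of 0] by auto
  have s: "(SUP \<mu>\<in>eigenvalues_on W T. ennreal (cmod \<mu>)) \<le> ennreal K"
    using bnd by (intro SUP_least ennreal_leI) auto
  have i: "ennreal (1 / C) \<le> (INF \<mu>\<in>eigenvalues_on W T. ennreal (cmod \<mu>))"
    using bnd C by (intro INF_greatest ennreal_leI) (auto simp: field_simps)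
  have "cond_number W T \<le> ennreal K / ennreal (1 / C)"
    unfolding cond_number_def divide_ennreal_def using 0 s i
    by (auto intro!: mult_mono ennreal_inverse_antimono)
  also have "\<dots> = ennreal (K * C)" using K C by (simp add: divide_ennreal)
  finally show ?thesis .
qed

section \<open>Meshes, restrictions and supports\<close>

text \<open>A facet of affine dimension d-1 has empty interior, and a convex set with empty interior
  is a null set.\<close>

lemma negligible_frontier_polyhedral_domain:
  assumes "polyhedral_domain E"
  shows "negligible (frontier E)"
proof -
  obtain F where F: "finite F" "frontier E = \<Union>F"
      "\<And>P. P \<in> F \<Longrightarrow> polytope P \<and> aff_dim P = int DIM('a) - 1"
    using assms unfolding polyhedral_domain_def by metis
  have "negligible P" if "P \<in> F" for P
  proof -
    have "interior P = {}" using F(3)[OF that] aff_dim_nonempty_interior[of P] by force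
    then show ?thesis using F(3)[OF that] by (simp add: negligible_convex_interior polytope_imp_convex)
  qed
  then show ?thesis unfolding F(2) using F(1) by (intro negligible_Union) auto
qed

text \<open>An element is the closure of its interior and has a null boundary; this converts
  disjoint interiors into overlaps of measure zero.\<close>

lemma mesh_element:
  assumes "mesh_partition D T" "\<tau> \<in> T"
  shows "closed \<tau>" "closure (interior \<tau>) = \<tau>" "interior \<tau> \<noteq> {}" "negligible (frontier \<tau>)"
proof -
  obtain E where E: "polyhedral_domain E" "\<tau> = closure E"
    using assms unfolding mesh_partition_def by metis
  have oE: "open E" "E \<noteq> {}" using E(1) by (simp_all add: polyhedral_domain_def)
  have sub: "E \<subseteq> interior \<tau>" unfolding E(2) using closure_subset oE(1) by (rule interior_maximal)
  show "closed \<tau>" by (simp add: E(2))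
  then show "closure (interior \<tau>) = \<tau>"
    using closure_mono[OF sub] closure_minimal[OF interior_subset] unfolding E(2) by (metis closed_closure subset_antisym)
  show "interior \<tau> \<noteq> {}" using sub oE by auto
  have "frontier \<tau> \<subseteq> frontier E"
    using sub interior_open[OF oE(1)] unfolding frontier_def E(2) by auto
  then show "negligible (frontier \<tau>)"
    using negligible_frontier_polyhedral_domain[OF E(1)] negligible_subset by blast
qed

section \<open>Almost-everywhere classes, restriction and support\<close>

lemma ae_eq_onI:
  assumes "D \<in> sets lebesgue" "negligible N" "\<And>x. x \<in> D \<Longrightarrow> x \<notin> N \<Longrightarrow> u x = v x"
  shows "ae_eq_on D u v"
proof -
  have "AE x in lebesgue. x \<in> D \<longrightarrow> u x = v x"
    by (rule AE_I'[of N]) (use assms in \<open>auto simp: negligible_iff_null_sets\<close>)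
  then show ?thesis unfolding ae_eq_on_def using assms(1) by (subst AE_restrict_space_iff) auto
qed

lemma ae_eq_on_refl: "ae_eq_on D u u"
  by (simp add: ae_eq_on_def)

lemma ae_eq_on_restr: "ae_eq_on D (restr D u) u"
  unfolding ae_eq_on_def by (rule AE_I2) (simp add: restr_def space_restrict_space)

text \<open>Both \<open>a_dom\<close> and \<open>s_dom\<close> have this shape, so their forms fit
  the locale \<open>nonneg_form\<close>.\<close>

lemma subspace_ae_class:
  assumes "cfun.subspace X"
  shows "cfun.subspace {u. \<exists>w\<in>X. ae_eq_on D u w}"
proof (rule cfun.subspaceI)
  show "0 \<in> {u. \<exists>w\<in>X. ae_eq_on D u w}"
    using cfun.subspace_0[OF assms] ae_eq_on_refl by auto
next
  fix u v assume "u \<in> {u. \<exists>w\<in>X. ae_eq_on D u w}" "v \<in> {u. \<exists>w\<in>X. ae_eq_on D u w}"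
  then obtain u' v' where X: "u' \<in> X" "v' \<in> X" and ae: "ae_eq_on D u u'" "ae_eq_on D v v'" by auto
  have "ae_eq_on D (u + v) (u' + v')"
    using ae unfolding ae_eq_on_def by eventually_elim simp
  then show "u + v \<in> {u. \<exists>w\<in>X. ae_eq_on D u w}"
    using cfun.subspace_add[OF assms X] by (intro CollectI bexI)
next
  fix c u assume "u \<in> {u. \<exists>w\<in>X. ae_eq_on D u w}"
  then obtain u' where X: "u' \<in> X" and ae: "ae_eq_on D u u'" by auto
  have "ae_eq_on D (cscale c u) (cscale c u')"
    using ae unfolding ae_eq_on_def by eventually_elim (simp add: cscale_def)
  then show "cscale c u \<in> {u. \<exists>w\<in>X. ae_eq_on D u w}"
    using cfun.subspace_scale[OF assms X] by (intro CollectI bexI)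
qed

lemma restr_add: "restr D (u + v) = restr D u + restr D v"
  and restr_cscale: "restr D (cscale c u) = cscale c (restr D u)"
  and restr_zero: "restr D 0 = 0"
  by (auto simp: restr_def cscale_def fun_eq_iff)

lemma subspace_restr_image:
  assumes "cfun.subspace X"
  shows "cfun.subspace (restr D ` X)"
proof (rule cfun.subspaceI)
  show "0 \<in> restr D ` X" using cfun.subspace_0[OF assms] restr_zero by (metis imageI)
next
  fix u v assume "u \<in> restr D ` X" "v \<in> restr D ` X"
  then obtain u' v' where X: "u' \<in> X" "v' \<in> X" and eq: "u = restr D u'" "v = restr D v'"
    by (elim imageE)
  show "u + v \<in> restr D ` X" unfolding eq restr_add[symmetric]
    using cfun.subspace_add[OF assms X] by (rule imageI)
next
  fix c u assume "u \<in> restr D ` X"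
  then obtain u' where X: "u' \<in> X" and eq: "u = restr D u'" by (elim imageE)
  show "cscale c u \<in> restr D ` X" unfolding eq restr_cscale[symmetric]
    using cfun.subspace_scale[OF assms X] by (rule imageI)
qed

lemma fin_dim_restr_image:
  assumes "fin_dim X"
  shows "fin_dim (restr D ` X)"
proof -
  obtain T where T: "finite T" "X = cfun.span T" using assms unfolding fin_dim_def by (elim exE conjE)
  let ?Y = "cfun.span (restr D ` T)"
  have "cfun.subspace {u. restr D u \<in> ?Y}"
  proof (rule cfun.subspaceI, unfold mem_Collect_eq restr_add restr_cscale restr_zero)
    show "0 \<in> ?Y" by (rule cfun.span_zero)
    show "restr D u + restr D v \<in> ?Y" if "restr D u \<in> ?Y" "restr D v \<in> ?Y" for u v
      using that by (rule cfun.span_add)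
    show "cscale c (restr D u) \<in> ?Y" if "restr D u \<in> ?Y" for c u
      using that by (rule cfun.span_scale)
  qed
  moreover have "T \<subseteq> {u. restr D u \<in> ?Y}" by (auto intro: cfun.span_base)
  ultimately have "X \<subseteq> {u. restr D u \<in> ?Y}" unfolding T(2) by (intro cfun.span_minimal)
  then have sub: "restr D ` X \<subseteq> ?Y" by auto
  have Y: "fin_dim ?Y"
    unfolding fin_dim_def by (intro exI[of _ "restr D ` T"] conjI finite_imageI T(1) refl)
  have "cfun.subspace (restr D ` X)"
    unfolding T(2) by (rule subspace_restr_image[OF cfun.subspace_span])
  from fin_dim_subspace[OF Y this sub] show ?thesis .
qed

lemma subspace_supp:
  assumes "cfun.subspace X"
  shows "cfun.subspace {u\<in>X. supp u \<subseteq> D}"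
proof (rule cfun.subspaceI)
  show "0 \<in> {u\<in>X. supp u \<subseteq> D}" using cfun.subspace_0[OF assms] by (simp add: supp_def)
next
  fix u v assume "u \<in> {u\<in>X. supp u \<subseteq> D}" "v \<in> {u\<in>X. supp u \<subseteq> D}"
  then have X: "u \<in> X" "v \<in> X" and supp: "supp u \<subseteq> D" "supp v \<subseteq> D" by simp_all
  have "supp (u + v) \<subseteq> supp u \<union> supp v"
    unfolding supp_def closure_Un[symmetric] by (intro closure_mono) auto
  then show "u + v \<in> {u\<in>X. supp u \<subseteq> D}"
    using cfun.subspace_add[OF assms X] subset_trans[OF _ Un_least[OF supp]] by (intro CollectI conjI)
next
  fix c u assume "u \<in> {u\<in>X. supp u \<subseteq> D}"
  then have X: "u \<in> X" and supp: "supp u \<subseteq> D" by simp_all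
  have "supp (cscale c u) \<subseteq> supp u"
    unfolding supp_def by (intro closure_mono) (auto simp: cscale_def)
  then show "cscale c u \<in> {u\<in>X. supp u \<subseteq> D}"
    using cfun.subspace_scale[OF assms X] subset_trans[OF _ supp] by (intro CollectI conjI)
qed

text \<open>For decreasing eigenvalues, the indices above the threshold form such a set; its
  cardinality \<open>l_sub\<close> is therefore the last retained index.\<close>

lemma downward_closed_atLeastAtMost:
  fixes A :: "nat set"
  assumes "\<And>j l. l \<in> A \<Longrightarrow> 1 \<le> j \<Longrightarrow> j \<le> l \<Longrightarrow> j \<in> A" "A \<subseteq> {1..n}"
  shows "A = {1..card A}"
proof -
  have fin: "finite A" using assms(2) finite_subset by blast
  have "j \<le> card A" if "j \<in> A" for j
  proof -
    have "{1..j} \<subseteq> A" using assms(1)[OF that] by auto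
    then show ?thesis using card_mono[OF fin, of "{1..j}"] by simp
  qed
  moreover have "j \<in> A" if j: "1 \<le> j" "j \<le> card A" for j
  proof (rule ccontr)
    assume "j \<notin> A"
    have "A \<subseteq> {1..j - 1}"
    proof
      fix l assume l: "l \<in> A"
      then have "\<not> j \<le> l" using assms(1)[OF l j(1)] \<open>j \<notin> A\<close> by blast
      then show "l \<in> {1..j - 1}" using l assms(2) by auto
    qed
    then have "card A \<le> j - 1" using card_mono[of "{1..j - 1}" A] by simp
    then show False using j by simp
  qed
  ultimately show ?thesis using assms(2) by auto
qed

text \<open>The form hypotheses speak only of unions of subsets of the mesh. This is the canonical
  subset for a region, so disjointness and covering can be checked element by element.\<close>

definition elems :: "'p schwarz \<Rightarrow> 'p set \<Rightarrow> 'p set set" where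
  "elems S D = {\<tau>\<in>mesh S. \<tau> \<subseteq> D}"

lemma elems_mesh: "elems S D \<subseteq> mesh S"
  by (auto simp: elems_def)

lemma Union_elems: "U \<subseteq> mesh S \<Longrightarrow> D = \<Union>U \<Longrightarrow> \<Union>(elems S D) = D"
  unfolding elems_def by blast

locale schwarz_geometry =
  fixes S :: "'p::euclidean_space schwarz"
  assumes geometry: "geometry S"
begin

abbreviation "I \<equiv> {1..nsub S}"

lemma mesh_partition: "mesh_partition (Omega S) (mesh S)"
  using geometry by (simp add: geometry_def)

lemma finite_mesh: "finite (mesh S)"
  using mesh_partition unfolding mesh_partition_def by (rule conjunct1)

lemma Union_mesh: "\<Union>(mesh S) = closure (Omega S)"
  using mesh_partition unfolding mesh_partition_def by (elim conjE)

lemmas element = mesh_element[OF mesh_partition]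

text \<open>An open set disjoint from \<open>interior \<sigma>\<close> is also disjoint from its
  closure, which is \<open>\<sigma>\<close>. So two elements can meet only on the frontier of
  \<open>\<tau>\<close>.\<close>

lemma negligible_element_Int:
  assumes "\<sigma> \<in> mesh S" "\<tau> \<in> mesh S" "\<sigma> \<noteq> \<tau>"
  shows "negligible (\<sigma> \<inter> \<tau>)"
proof -
  have "interior \<sigma> \<inter> interior \<tau> = {}"
    using mesh_partition assms unfolding mesh_partition_def by metis
  then have "closure (interior \<sigma>) \<inter> interior \<tau> = {}"
    by (simp add: open_Int_closure_eq_empty Int_commute)
  then have "\<sigma> \<inter> \<tau> \<subseteq> frontier \<tau>"
    using element(2)[OF assms(1)] element(1)[OF assms(2)] by (auto simp: frontier_def)
  then show ?thesis using element(4)[OF assms(2)] negligible_subset by blast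
qed

lemma negligible_Union_Int:
  assumes "U \<subseteq> mesh S" "W \<subseteq> mesh S" "U \<inter> W = {}"
  shows "negligible (\<Union>U \<inter> \<Union>W)"
proof -
  have "\<Union>U \<inter> \<Union>W = (\<Union>(\<sigma>, \<tau>)\<in>U \<times> W. \<sigma> \<inter> \<tau>)" by auto
  moreover have "finite (U \<times> W)" using assms finite_mesh finite_subset by blast
  then have "negligible (\<Union>(\<sigma>, \<tau>)\<in>U \<times> W. \<sigma> \<inter> \<tau>)"
    using assms by (intro negligible_Union) (auto intro!: negligible_element_Int)
  ultimately show ?thesis by simp
qed

lemma closed_Union_mesh: "U \<subseteq> mesh S \<Longrightarrow> closed (\<Union>U)"
  by (rule closed_Union) (auto intro: element(1) finite_subset[OF _ finite_mesh])

lemma lebesgue_Union: "U \<subseteq> mesh S \<Longrightarrow> \<Union>U \<in> sets lebesgue"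
  by (metis borel_closed closed_Union_mesh sets_completionI_sets sets_lborel)

lemma closure_interior_Union:
  assumes "U \<subseteq> mesh S"
  shows "closure (interior (\<Union>U)) = \<Union>U"
proof
  show "closure (interior (\<Union>U)) \<subseteq> \<Union>U"
    using interior_subset closed_Union_mesh[OF assms] by (rule closure_minimal)
  have "\<tau> \<subseteq> closure (interior (\<Union>U))" if "\<tau> \<in> U" for \<tau>
  proof -
    have "closure (interior \<tau>) \<subseteq> closure (interior (\<Union>U))"
      using that by (intro closure_mono interior_mono) auto
    then show ?thesis using element(2) assms that by auto
  qed
  then show "\<Union>U \<subseteq> closure (interior (\<Union>U))" by blast
qed

lemma add_layer_superset:
  assumes "U \<subseteq> mesh S"
  shows "U \<subseteq> (add_layer (mesh S) ^^ m) U \<and> (add_layer (mesh S) ^^ m) U \<subseteq> mesh S"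
proof (induction m)
  case (Suc m)
  let ?W = "(add_layer (mesh S) ^^ m) U"
  have "?W \<subseteq> add_layer (mesh S) ?W"

  proof
    fix \<tau> assume "\<tau> \<in> ?W"
    moreover from this have "\<tau> \<in> mesh S" using Suc by blast
    moreover from this have "\<tau> \<noteq> {}" using element(3)[of \<tau>] by auto
    ultimately show "\<tau> \<in> add_layer (mesh S) ?W" unfolding add_layer_def by blast
  qed
  moreover have "add_layer (mesh S) ?W \<subseteq> mesh S" by (auto simp: add_layer_def)
  ultimately show ?case using Suc by auto
qed (use assms in auto)

lemma subdomain:
  assumes i: "i \<in> I"
  shows "open (sub S i)" "sub S i \<noteq> {}" "\<Union>(elems S (closure (sub S i))) = closure (sub S i)"
    "\<Union>(elems S (closure (ovl S i))) = closure (ovl S i)"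
    "interior (closure (ovl S i)) = ovl S i" "closure (sub S i) \<subseteq> closure (ovl S i)" "sub S i \<subseteq> ovl S i"
proof -
  obtain U m where U: "U \<subseteq> mesh S" "closure (sub S i) = \<Union>U"
      "ovl S i = interior (\<Union>((add_layer (mesh S) ^^ m) U))"
    and o: "open (sub S i)" "sub S i \<noteq> {}"
  proof -
    have "\<forall>i\<in>I. open (sub S i) \<and> sub S i \<noteq> {} \<and> sub S i \<subseteq> Omega S \<and>
        (\<exists>U\<subseteq>mesh S. closure (sub S i) = \<Union>U \<and>
           (\<exists>m\<ge>1. ovl S i = interior (\<Union>((add_layer (mesh S) ^^ m) U))))"
      using geometry unfolding geometry_def by (elim conjE)
    from bspec[OF this i] show ?thesis using that by (elim conjE exE)
  qed
  let ?W = "(add_layer (mesh S) ^^ m) U"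
  have W: "U \<subseteq> ?W" "?W \<subseteq> mesh S" using add_layer_superset[OF U(1)] by auto
  have clo: "closure (ovl S i) = \<Union>?W" unfolding U(3) by (rule closure_interior_Union[OF W(2)])
  show "open (sub S i)" "sub S i \<noteq> {}" by (rule o)+
  show "\<Union>(elems S (closure (sub S i))) = closure (sub S i)" by (rule Union_elems[OF U(1,2)])
  show "\<Union>(elems S (closure (ovl S i))) = closure (ovl S i)" by (rule Union_elems[OF W(2) clo])
  show "interior (closure (ovl S i)) = ovl S i" unfolding clo by (rule U(3)[symmetric])
  show sub: "closure (sub S i) \<subseteq> closure (ovl S i)" unfolding U(2) clo using W(1) by blast
  show "sub S i \<subseteq> ovl S i"
    using interior_maximal[OF subset_trans[OF closure_subset sub] o(1)]
    unfolding clo U(3)[symmetric] .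
qed

text \<open>A common element would put its nonempty interior into both overlapping subdomains,
  because each of these is the interior of its closure.\<close>

lemma elems_ovl_disjoint:
  assumes "i \<in> I" "j \<in> I" "ovl S i \<inter> ovl S j = {}"
  shows "elems S (closure (ovl S i)) \<inter> elems S (closure (ovl S j)) = {}"
proof (rule ccontr)
  assume "\<not> ?thesis"
  then obtain \<tau> where \<tau>: "\<tau> \<in> mesh S" "\<tau> \<subseteq> closure (ovl S i)" "\<tau> \<subseteq> closure (ovl S j)"
    by (auto simp: elems_def)
  have "interior \<tau> \<subseteq> ovl S i" "interior \<tau> \<subseteq> ovl S j"
    using interior_mono[OF \<tau>(2)] interior_mono[OF \<tau>(3)] subdomain(5) assms by auto
  then show False using element(3)[OF \<tau>(1)] assms(3) by blast
qed

text \<open>A subdomain is not known to be the interior of its closure, so density is used instead: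
  inside a common element, first one subdomain and then the other must be met by a nonempty open
  set.\<close>

lemma elems_sub_disjoint:
  assumes "i \<in> I" "j \<in> I" "i \<noteq> j"
  shows "elems S (closure (sub S i)) \<inter> elems S (closure (sub S j)) = {}"
proof (rule ccontr)
  assume "\<not> ?thesis"
  then obtain \<tau> where \<tau>: "\<tau> \<in> mesh S" "\<tau> \<subseteq> closure (sub S i)" "\<tau> \<subseteq> closure (sub S j)"
    by (auto simp: elems_def)
  have dis: "sub S i \<inter> sub S j = {}"
  proof -
    have "\<forall>i\<in>I. \<forall>j\<in>I. i \<noteq> j \<longrightarrow> sub S i \<inter> sub S j = {}"
      using geometry unfolding geometry_def by (elim conjE)
    then show ?thesis using assms by blast
  qed
  have "interior \<tau> \<inter> closure (sub S i) \<noteq> {}"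
    using \<tau>(2) element(3)[OF \<tau>(1)] interior_subset by blast
  then have ne: "interior \<tau> \<inter> sub S i \<noteq> {}" by (simp add: open_Int_closure_eq_empty)
  moreover have "open (interior \<tau> \<inter> sub S i)" using subdomain(1) assms by auto
  moreover have "interior \<tau> \<inter> sub S i \<inter> closure (sub S j) \<noteq> {}"
    using ne \<tau>(3) interior_subset by blast
  ultimately have "interior \<tau> \<inter> sub S i \<inter> sub S j \<noteq> {}"
    using open_Int_closure_eq_empty[of "interior \<tau> \<inter> sub S i" "sub S j"] by blast
  then show False using dis by blast
qed

text \<open>The subdomain closures cover the domain only as point sets. An element outside the
  collection would be covered by other elements, each meeting it in a null set, although its
  interior is nonempty and open.\<close>

lemma elems_sub_cover: "(\<Union>i\<in>I. elems S (closure (sub S i))) = mesh S"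
proof
  let ?U = "\<Union>i\<in>I. elems S (closure (sub S i))"
  show U: "?U \<subseteq> mesh S" using elems_mesh by blast
  show "mesh S \<subseteq> ?U"
  proof
    fix \<tau> assume \<tau>: "\<tau> \<in> mesh S"
    show "\<tau> \<in> ?U"
    proof (rule ccontr)
      assume nin: "\<tau> \<notin> ?U"
      have "closure (Omega S) = (\<Union>i\<in>I. closure (sub S i))"
        using geometry unfolding geometry_def by (elim conjE)
      also have "\<dots> = (\<Union>i\<in>I. \<Union>(elems S (closure (sub S i))))" using subdomain(3) by simp
      also have "\<dots> = \<Union>?U" by blast
      finally have "\<tau> \<subseteq> \<Union>?U" using \<tau> Union_mesh by blast
      moreover have "negligible (\<Union>{\<tau>} \<inter> \<Union>?U)" by (rule negligible_Union_Int) (use U \<tau> nin in auto)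
      ultimately have "negligible \<tau>" by (simp add: Int_absorb2)
      then have "negligible (interior \<tau>)" using interior_subset negligible_subset by blast
      then show False using element(3)[OF \<tau>] open_not_negligible open_interior by blast
    qed
  qed
qed

lemma ovl_idx_sym: "i \<in> I \<Longrightarrow> j \<in> I \<Longrightarrow> j \<in> ovl_idx S i \<longleftrightarrow> i \<in> ovl_idx S j"
  by (auto simp: ovl_idx_def)

lemma card_ovl_idx_le: "i \<in> I \<Longrightarrow> card (ovl_idx S i) \<le> max_ovl S"
  unfolding max_ovl_def by (intro Max_ge) auto

text \<open>Every subdomain overlaps itself. Positivity is what allows the Young weight 1/M.\<close>

lemma max_ovl_pos: "0 < max_ovl S"
proof -
  have "polyhedral_domain (Omega S)" using geometry unfolding geometry_def by (elim conjE)
  then have "closure (Omega S) \<noteq> {}" by (simp add: polyhedral_domain_def)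
  moreover have "closure (Omega S) = (\<Union>i\<in>I. closure (sub S i))"
    using geometry unfolding geometry_def by (elim conjE)
  ultimately obtain i where i: "i \<in> I" by (metis UN_empty ex_in_conv)
  then have "i \<in> ovl_idx S i" using subdomain(2,7)[OF i] by (auto simp: ovl_idx_def)
  moreover have "finite (ovl_idx S i)" by (simp add: ovl_idx_def)
  ultimately have "0 < card (ovl_idx S i)" using card_gt_0_iff by blast
  then show ?thesis using card_ovl_idx_le[OF i] by linarith
qed

end

section \<open>Energy forms and cutoff functions\<close>

lemma nonneg_formI: "cfun.subspace W \<Longrightarrow> nonneg_form_on W B \<Longrightarrow> nonneg_form W B"
  by (simp add: nonneg_form_on_def nonneg_form_def herm_form_def nonneg_form_axioms_def)

lemma pos_formI: "cfun.subspace W \<Longrightarrow> pos_def_form_on W B \<Longrightarrow> pos_form W B"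
  by (simp add: pos_def_form_on_def pos_form_def herm_form_def pos_form_axioms_def)

lemma supp_zero: "supp u \<subseteq> D \<Longrightarrow> x \<notin> D \<Longrightarrow> u x = 0"
  unfolding supp_def using closure_subset[of "{x. u x \<noteq> 0}"] by blast

locale schwarz_spaces = schwarz_geometry +
  assumes spaces: "spaces_and_forms S"
begin

text \<open>In contrast to \<open>a_dom S D\<close>, this space does not vary with the region, so
  one membership fact serves all parts of an additive splitting.\<close>

abbreviation "adm \<equiv> cfun.span (V_space S \<union> Vh S \<union> cutoff_products S)"

lemma fin_dim_Vh: "fin_dim (Vh S)"
  using spaces unfolding spaces_and_forms_def fin_dim_def by (elim conjE)

lemma subspace_Vh: "cfun.subspace (Vh S)"
  using fin_dim_Vh unfolding fin_dim_def by (metis cfun.subspace_span)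

lemma Vh_L2: "Vh S \<subseteq> L2_on (Omega S)"
  using spaces unfolding spaces_and_forms_def by (elim conjE)

lemma Vh_zero: "u \<in> Vh S \<Longrightarrow> x \<notin> closure (Omega S) \<Longrightarrow> u x = 0"
proof -
  have "\<forall>u\<in>Vh S. \<forall>x. x \<notin> closure (Omega S) \<longrightarrow> u x = 0"
    using spaces unfolding spaces_and_forms_def by (elim conjE)
  then show "u \<in> Vh S \<Longrightarrow> x \<notin> closure (Omega S) \<Longrightarrow> u x = 0" by blast
qed

lemma pos_Vh_ip: "pos_form (Vh S) (Vh_ip S)"
  by (rule pos_formI[OF subspace_Vh]) (use spaces in \<open>unfold spaces_and_forms_def, elim conjE\<close>)

sublocale a: pos_form "Vh S" "a_full S"
  by (rule pos_formI[OF subspace_Vh]) (use spaces in \<open>unfold spaces_and_forms_def, elim conjE\<close>)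

lemma nonneg_aform:
  assumes "U \<subseteq> mesh S"
  shows "nonneg_form (a_dom S (\<Union>U)) (aform S (\<Union>U))"
proof (rule nonneg_formI)
  show "cfun.subspace (a_dom S (\<Union>U))"
    unfolding a_dom_def by (rule subspace_ae_class[OF cfun.subspace_span])
  show "nonneg_form_on (a_dom S (\<Union>U)) (aform S (\<Union>U))"
    using spaces assms unfolding spaces_and_forms_def by metis
qed

lemma aform_cong:
  assumes "U \<subseteq> mesh S" "u \<in> a_dom S (\<Union>U)" "u' \<in> a_dom S (\<Union>U)" "v \<in> a_dom S (\<Union>U)"
    and "ae_eq_on (\<Union>U) u u'"
  shows "aform S (\<Union>U) u v = aform S (\<Union>U) u' v"
proof -
  have "\<forall>U\<subseteq>mesh S. nonneg_form_on (a_dom S (\<Union>U)) (aform S (\<Union>U)) \<and>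
        (\<forall>u\<in>a_dom S (\<Union>U). \<forall>u'\<in>a_dom S (\<Union>U). \<forall>v\<in>a_dom S (\<Union>U).
           ae_eq_on (\<Union>U) u u' \<longrightarrow> aform S (\<Union>U) u v = aform S (\<Union>U) u' v)"
    using spaces unfolding spaces_and_forms_def by (elim conjE)
  then show ?thesis using assms by blast
qed

lemma adm_a_dom: "u \<in> adm \<Longrightarrow> u \<in> a_dom S D"
  unfolding a_dom_def using ae_eq_on_refl by (intro CollectI bexI)

lemma Vh_adm: "u \<in> Vh S \<Longrightarrow> u \<in> adm"
  by (intro cfun.span_base UnI1 UnI2)

lemma cutoff_adm: "u \<in> cutoff_products S \<Longrightarrow> u \<in> adm"
  by (intro cfun.span_base UnI2)

lemma aform_Un:
  assumes "U \<subseteq> mesh S" "W \<subseteq> mesh S" "U \<inter> W = {}" "u \<in> adm" "v \<in> adm"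
  shows "aform S (\<Union>(U \<union> W)) u v = aform S (\<Union>U) u v + aform S (\<Union>W) u v"
proof -
  have "\<forall>U\<subseteq>mesh S. \<forall>W\<subseteq>mesh S. U \<inter> W = {} \<longrightarrow>
        (\<forall>u\<in>a_dom S (\<Union>(U \<union> W)). \<forall>v\<in>a_dom S (\<Union>(U \<union> W)).
           aform S (\<Union>(U \<union> W)) u v = aform S (\<Union>U) u v + aform S (\<Union>W) u v)"
    using spaces unfolding spaces_and_forms_def by (elim conjE)
  then have "\<forall>u\<in>a_dom S (\<Union>(U \<union> W)). \<forall>v\<in>a_dom S (\<Union>(U \<union> W)).
           aform S (\<Union>(U \<union> W)) u v = aform S (\<Union>U) u v + aform S (\<Union>W) u v"
    using assms(1-3) by blast
  from bspec[OF bspec[OF this adm_a_dom[OF assms(4)]] adm_a_dom[OF assms(5)]] show ?thesis .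
qed

lemma aform_UN:
  assumes "finite J" "\<And>i. i \<in> J \<Longrightarrow> F i \<subseteq> mesh S"
    and "\<And>i j. i \<in> J \<Longrightarrow> j \<in> J \<Longrightarrow> i \<noteq> j \<Longrightarrow> F i \<inter> F j = {}"
    and uv: "u \<in> adm" "v \<in> adm"
  shows "aform S (\<Union>(\<Union>i\<in>J. F i)) u v = (\<Sum>i\<in>J. aform S (\<Union>(F i)) u v)"
  using assms(1-3)
proof (induction J rule: finite_induct)
  case empty
  \<comment> \<open>Additivity for two empty patches reads \<open>x = x + x\<close>, which forces
    the form on the empty region to vanish.\<close>
  show ?case using aform_Un[OF _ _ _ uv, of "{}" "{}"] by simp
next
  case (insert i J)
  have "F i \<inter> (\<Union>j\<in>J. F j) = {}" using insert.hyps insert.prems(2) by blast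
  moreover have "(\<Union>j\<in>J. F j) \<subseteq> mesh S" "F i \<subseteq> mesh S" using insert.prems(1) by auto
  ultimately have "aform S (\<Union>(F i \<union> (\<Union>j\<in>J. F j))) u v
      = aform S (\<Union>(F i)) u v + aform S (\<Union>(\<Union>j\<in>J. F j)) u v"
    using uv by (intro aform_Un)
  also have "aform S (\<Union>(\<Union>j\<in>J. F j)) u v = (\<Sum>j\<in>J. aform S (\<Union>(F j)) u v)"
    by (rule insert.IH) (use insert.prems in auto)
  finally show ?case using insert.hyps by simp
qed

lemma a_full_elements:
  assumes "u \<in> adm" "v \<in> adm"
  shows "a_full S u v = (\<Sum>\<tau>\<in>mesh S. aform S \<tau> u v)"
  using aform_UN[OF finite_mesh _ _ assms, of "\<lambda>\<tau>. {\<tau>}"] by (simp add: a_full_def Union_mesh)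

lemma a_full_subdomains:
  assumes "u \<in> adm" "v \<in> adm"
  shows "a_full S u v = (\<Sum>i\<in>I. a_sub S i u v)"
proof -
  let ?F = "\<lambda>i. elems S (closure (sub S i))"
  have "a_full S u v = aform S (\<Union>(\<Union>i\<in>I. ?F i)) u v"
    unfolding elems_sub_cover Union_mesh a_full_def ..
  also have "\<dots> = (\<Sum>i\<in>I. aform S (\<Union>(?F i)) u v)"
    using assms by (intro aform_UN elems_sub_disjoint elems_mesh) auto
  also have "\<dots> = (\<Sum>i\<in>I. a_sub S i u v)"
    by (intro sum.cong refl) (simp only: subdomain(3) a_sub_def)
  finally show ?thesis .
qed

lemma qf_a_full_elements: "u \<in> adm \<Longrightarrow> qf (a_full S) u = (\<Sum>\<tau>\<in>mesh S. qf (aform S \<tau>) u)"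
  unfolding qf_def using a_full_elements[of u u] by simp

lemma qf_a_full_subdomains: "u \<in> adm \<Longrightarrow> qf (a_full S) u = (\<Sum>i\<in>I. qf (a_sub S i) u)"
  unfolding qf_def using a_full_subdomains[of u u] by simp

lemma qf_element_nonneg: "\<tau> \<in> mesh S \<Longrightarrow> u \<in> adm \<Longrightarrow> 0 \<le> qf (aform S \<tau>) u"
  using nonneg_form.nonneg[OF nonneg_aform[of "{\<tau>}"] adm_a_dom] by simp

text \<open>The two patches share only a null set, so \<open>u\<close> is almost everywhere zero on
  the first one and may be replaced by 0 in the form.\<close>

lemma aform_null:
  assumes "U \<subseteq> mesh S" "W \<subseteq> mesh S" "U \<inter> W = {}" "u \<in> adm" "v \<in> adm"
    and "\<And>x. x \<notin> \<Union>W \<Longrightarrow> u x = 0"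
  shows "aform S (\<Union>U) u v = 0"
proof -
  interpret nonneg_form "a_dom S (\<Union>U)" "aform S (\<Union>U)" by (rule nonneg_aform[OF assms(1)])
  have "ae_eq_on (\<Union>U) u 0"
    using lebesgue_Union[OF assms(1)] negligible_Union_Int[OF assms(1-3)]
    by (rule ae_eq_onI) (use assms(6) in auto)
  then have "aform S (\<Union>U) u v = aform S (\<Union>U) 0 v"
    using assms(1,4,5) mem(1) adm_a_dom by (intro aform_cong)
  then show ?thesis using zero_left[OF adm_a_dom[OF assms(5)]] by simp
qed

lemma Vh_ovl_Vh: "Vh_ovl S j \<subseteq> Vh S"
  by (auto simp: Vh_ovl_def Vh_supp_def)

lemma subspace_Vh_supp: "cfun.subspace (Vh_supp S D)"
  unfolding Vh_supp_def by (rule subspace_supp[OF subspace_Vh])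

lemma Vh_ovl_zero: "j \<in> I \<Longrightarrow> u \<in> Vh_ovl S j \<Longrightarrow> x \<notin> \<Union>(elems S (closure (ovl S j))) \<Longrightarrow> u x = 0"
  unfolding subdomain(4) by (auto simp: Vh_ovl_def Vh_supp_def intro: supp_zero)

text \<open>No energy is lost outside the support. This makes the operator in \<open>A_loc\<close> a
  restriction of the global energy, as \<open>subspace_solve\<close> requires.\<close>

lemma aform_ovl:
  assumes j: "j \<in> I" and u: "u \<in> Vh_ovl S j" and v: "v \<in> Vh S"
  shows "aform S (closure (ovl S j)) u v = a_full S u v"
proof -
  let ?W = "elems S (closure (ovl S j))"
  have uv: "u \<in> adm" "v \<in> adm" using u v Vh_ovl_Vh by (auto intro: Vh_adm)
  have "(mesh S - ?W) \<union> ?W = mesh S" "(mesh S - ?W) \<inter> ?W = {}" using elems_mesh by blast+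
  then have "a_full S u v = aform S (\<Union>(mesh S - ?W)) u v + aform S (\<Union>?W) u v"
    using aform_Un[of "mesh S - ?W" ?W, OF _ elems_mesh _ uv] by (simp add: a_full_def flip: Union_mesh)
  also have "aform S (\<Union>(mesh S - ?W)) u v = 0"
    by (rule aform_null[OF _ elems_mesh _ uv]) (use Vh_ovl_zero[OF j u] in auto)
  finally show ?thesis by (simp add: subdomain(4)[OF j])
qed

text \<open>The pairing is confined to the patch of \<open>u\<close>, where \<open>v\<close>
  vanishes almost everywhere. Since \<open>aform_null\<close> acts on the first argument, Hermitian
  symmetry swaps the two.\<close>

lemma a_full_orthogonal:
  assumes jl: "j \<in> I" "l \<in> I" "l \<notin> ovl_idx S j" and u: "u \<in> Vh_ovl S j" and v: "v \<in> Vh_ovl S l"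
  shows "a_full S u v = 0"
proof -
  let ?U = "elems S (closure (ovl S j))" and ?W = "elems S (closure (ovl S l))"
  have uv: "u \<in> Vh S" "v \<in> Vh S" using u v Vh_ovl_Vh by auto
  interpret nonneg_form "a_dom S (\<Union>?U)" "aform S (\<Union>?U)" by (rule nonneg_aform[OF elems_mesh])
  have "ovl S j \<inter> ovl S l = {}" using jl by (auto simp: ovl_idx_def)
  then have "aform S (\<Union>?U) v u = 0"
    using Vh_ovl_zero[OF jl(2) v] elems_ovl_disjoint[OF jl(1,2)] uv
    by (intro aform_null[OF elems_mesh elems_mesh]) (auto intro: Vh_adm)
  then have "aform S (\<Union>?U) u v = 0"
    using cnj[OF adm_a_dom adm_a_dom, OF Vh_adm Vh_adm, OF uv(2,1)] by simp
  then show ?thesis using aform_ovl[OF jl(1) u uv(2)] by (simp add: subdomain(4)[OF jl(1)])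
qed

end

section \<open>Products with the partition of unity\<close>

locale schwarz_cutoffs = schwarz_spaces +
  assumes pou: "partition_of_unity S"
begin

abbreviation cutoff :: "nat \<Rightarrow> 'a cfun \<Rightarrow> 'a cfun" where
  "cutoff j u \<equiv> (\<lambda>x. of_real (pou S j x) * u x)"

lemma cutoff_products: "j \<in> I \<Longrightarrow> u \<in> Vh S \<Longrightarrow> cutoff j u \<in> cutoff_products S"
  unfolding cutoff_products_def by (intro CollectI exI[of _ "{j}"] exI[of _ u]) auto

text \<open>An identity at every point: off the closed domain, where the cutoffs need not sum to 1,
  \<open>u\<close> itself is 0.\<close>

lemma sum_cutoff:
  assumes "u \<in> Vh S"
  shows "(\<Sum>j\<in>I. cutoff j u) = u"
proof
  fix x
  have "(\<Sum>j\<in>I. cutoff j u) x = of_real (\<Sum>j\<in>I. pou S j x) * u x"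
    by (simp add: sum_cfun_apply sum_distrib_right)
  also have "\<dots> = u x"
    using Vh_zero[OF assms, of x] pou by (cases "x \<in> closure (Omega S)") (auto simp: partition_of_unity_def)
  finally show "(\<Sum>j\<in>I. cutoff j u) x = u x" .
qed

text \<open>Additivity of \<open>interp\<close> is available on \<open>L2_on\<close> only, so the
  pieces must be shown square integrable before the interpolant of their sum is split.\<close>

lemma cutoff_L2:
  assumes j: "j \<in> I" and u: "u \<in> Vh S"
  shows "cutoff j u \<in> L2_on (Omega S)"
proof -
  let ?M = "lebesgue_on (Omega S)"
  have um[measurable]: "u \<in> borel_measurable ?M" and ui: "integrable ?M (\<lambda>x. (cmod (u x))\<^sup>2)"
    using Vh_L2 u by (auto simp: L2_on_def)
  have pm[measurable]: "pou S j \<in> borel_measurable ?M"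
    using pou j by (auto simp: partition_of_unity_def)
  have p1: "\<bar>pou S j x\<bar> \<le> 1" if "x \<in> Omega S" for x
  proof -
    have "0 \<le> pou S j x \<and> pou S j x \<le> 1"
      using pou j subsetD[OF closure_subset that] unfolding partition_of_unity_def by blast
    then show ?thesis by auto
  qed
  have "integrable ?M (\<lambda>x. (cmod (cutoff j u x))\<^sup>2)"
  proof (rule Bochner_Integration.integrable_bound[OF ui])
    have "(cmod (cutoff j u x))\<^sup>2 \<le> (cmod (u x))\<^sup>2" if "x \<in> Omega S" for x
      using p1[OF that] mult_right_mono[OF p1[OF that], of "cmod (u x)"]
      by (intro power_mono) (auto simp: norm_mult)
    then show "AE x in ?M. norm ((cmod (cutoff j u x))\<^sup>2) \<le> norm ((cmod (u x))\<^sup>2)"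
      by (intro AE_I2) (auto simp: space_restrict_space)
  qed measurable
  then show ?thesis by (auto simp: L2_on_def)
qed

text \<open>Complements Assumption 1, which bounds a cutoff on a subdomain only for indices in
  \<open>ovl_idx\<close>.\<close>

lemma qf_a_sub_cutoff_eq_0:
  assumes ij: "i \<in> I" "j \<in> I" "j \<notin> ovl_idx S i" and u: "u \<in> Vh S"
  shows "qf (a_sub S i) (cutoff j u) = 0"
proof -
  let ?U = "elems S (closure (sub S i))" and ?W = "elems S (closure (ovl S j))"
  have "ovl S i \<inter> ovl S j = {}" using ij by (auto simp: ovl_idx_def)
  then have "elems S (closure (ovl S i)) \<inter> ?W = {}" by (rule elems_ovl_disjoint[OF ij(1,2)])
  moreover have "?U \<subseteq> elems S (closure (ovl S i))" using subdomain(6)[OF ij(1)] by (auto simp: elems_def)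
  ultimately have "?U \<inter> ?W = {}" by blast
  moreover have "supp (pou S j) \<subseteq> closure (ovl S j)" using pou ij by (auto simp: partition_of_unity_def)
  then have "cutoff j u x = 0" if "x \<notin> \<Union>?W" for x
    using that supp_zero[of "pou S j"] unfolding subdomain(4)[OF ij(2)] by auto
  moreover have "cutoff j u \<in> adm" by (intro cutoff_adm cutoff_products ij u)
  ultimately have "aform S (\<Union>?U) (cutoff j u) (cutoff j u) = 0"
    by (intro aform_null[OF elems_mesh elems_mesh])
  then show ?thesis by (simp add: qf_def a_sub_def subdomain(3)[OF ij(1)])
qed

end

section \<open>Local eigenproblems and the stable decomposition\<close>

lemma L2_on_add:
  assumes "u \<in> L2_on D" "v \<in> L2_on D"
  shows "u + v \<in> L2_on D"
proof -
  let ?M = "lebesgue_on D"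
  have um[measurable]: "u \<in> borel_measurable ?M" and vm[measurable]: "v \<in> borel_measurable ?M"
    and i: "integrable ?M (\<lambda>x. (cmod (u x))\<^sup>2)" "integrable ?M (\<lambda>x. (cmod (v x))\<^sup>2)"
    using assms by (auto simp: L2_on_def)
  have bnd: "(cmod (u x + v x))\<^sup>2 \<le> 2 * (cmod (u x))\<^sup>2 + 2 * (cmod (v x))\<^sup>2" for x
  proof -
    have "(cmod (u x + v x))\<^sup>2 \<le> (cmod (u x) + cmod (v x))\<^sup>2"
      by (intro power_mono norm_triangle_ineq) auto
    then show ?thesis
      using sum_squares_bound[of "cmod (u x)" "cmod (v x)"] by (simp add: power2_sum)
  qed
  have "integrable ?M (\<lambda>x. (cmod (u x + v x))\<^sup>2)"
  proof (rule Bochner_Integration.integrable_bound)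
    show "integrable ?M (\<lambda>x. 2 * (cmod (u x))\<^sup>2 + 2 * (cmod (v x))\<^sup>2)" using i by simp
    show "AE x in ?M. norm ((cmod (u x + v x))\<^sup>2) \<le> norm (2 * (cmod (u x))\<^sup>2 + 2 * (cmod (v x))\<^sup>2)"
      using bnd by (intro AE_I2) simp
  qed measurable
  moreover have "(\<lambda>x. u x + v x) \<in> borel_measurable ?M" by measurable
  ultimately show ?thesis by (simp add: L2_on_def plus_fun_def)
qed

lemma zero_L2_on: "0 \<in> L2_on D"
  by (simp add: L2_on_def zero_fun_def)

locale two_level_schwarz = schwarz_cutoffs +
  fixes \<Lambda> Ct CIa CIs Cp c :: real and k :: nat
  assumes Lambda: "1 < \<Lambda>" and eig: "eigenproblems S"
    and as1: "assumption1 S Ct" and as2: "assumption2 S CIa CIs" and as3: "assumption3 S \<Lambda> Cp c"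
begin

abbreviation "D i \<equiv> closure (sub S i)"
abbreviation "coef i v j \<equiv> sform S i v (eigfun S i j)"

lemma subspace_Vh_sub: "cfun.subspace (Vh_sub S i)" and fin_dim_Vh_sub: "fin_dim (Vh_sub S i)"
  unfolding Vh_sub_def by (rule subspace_restr_image[OF subspace_Vh], rule fin_dim_restr_image[OF fin_dim_Vh])

lemma as1D:
  assumes "i \<in> I"
  shows "pos_def_form_on (Vh_sub S i) (sform S i)" "nonneg_form_on (s_dom S i) (sform S i)"
    "\<forall>u\<in>s_dom S i. \<forall>u'\<in>s_dom S i. \<forall>v\<in>s_dom S i. ae_eq_on (D i) u u' \<longrightarrow> sform S i u v = sform S i u' v"
    "\<forall>j\<in>ovl_idx S i. \<forall>u\<in>Vh S. qf (a_sub S i) (cutoff j u) \<le> Ct * (qf (a_sub S i) u + qf (sform S i) u)"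
proof -
  note * = as1[unfolded assumption1_def, THEN conjunct2, THEN bspec, OF assms]
  note ** = *[THEN conjunct2, THEN conjunct2]
  show "pos_def_form_on (Vh_sub S i) (sform S i)" by (rule *[THEN conjunct1])
  show "nonneg_form_on (s_dom S i) (sform S i)" by (rule *[THEN conjunct2, THEN conjunct1])
  show "\<forall>u\<in>s_dom S i. \<forall>u'\<in>s_dom S i. \<forall>v\<in>s_dom S i. ae_eq_on (D i) u u' \<longrightarrow> sform S i u v = sform S i u' v"
    by (rule **[THEN conjunct1])
  show "\<forall>j\<in>ovl_idx S i. \<forall>u\<in>Vh S. qf (a_sub S i) (cutoff j u) \<le> Ct * (qf (a_sub S i) u + qf (sform S i) u)"
    by (rule **[THEN conjunct2, THEN conjunct1])
qed

lemma Ct_pos: "0 < Ct"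
  using as1 unfolding assumption1_def by (rule conjunct1)

lemma pos_sform: "i \<in> I \<Longrightarrow> pos_form (Vh_sub S i) (sform S i)"
  by (rule pos_formI[OF subspace_Vh_sub as1D(1)])

lemma nonneg_sform: "i \<in> I \<Longrightarrow> nonneg_form (s_dom S i) (sform S i)"
  by (rule nonneg_formI[OF _ as1D(2)]) (unfold s_dom_def, rule subspace_ae_class[OF cfun.subspace_span])

lemma sform_cong:
  assumes "i \<in> I" "u \<in> s_dom S i" "u' \<in> s_dom S i" "v \<in> s_dom S i" "ae_eq_on (D i) u u'"
  shows "sform S i u v = sform S i u' v"
  using as1D(3)[OF assms(1)] assms(2-) by blast

lemma Vh_span: "v \<in> Vh S \<Longrightarrow> v \<in> cfun.span (V_space S \<union> Vh S \<union> X)"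
  by (intro cfun.span_base UnI1 UnI2)

lemma Vh_s_dom: "v \<in> Vh S \<Longrightarrow> v \<in> s_dom S i"
  unfolding s_dom_def by (intro CollectI bexI[of _ v] ae_eq_on_refl Vh_span)

lemma restr_s_dom: "v \<in> Vh S \<Longrightarrow> restr (D i) v \<in> s_dom S i"
  unfolding s_dom_def by (intro CollectI bexI[of _ v] ae_eq_on_restr Vh_span)

lemma restr_a_dom: "v \<in> Vh S \<Longrightarrow> restr (D i) v \<in> a_dom S (D i)"
  unfolding a_dom_def by (intro CollectI bexI[of _ v] ae_eq_on_restr Vh_span)

lemma Vh_sub_s_dom: "v \<in> Vh_sub S i \<Longrightarrow> v \<in> s_dom S i"
  unfolding Vh_sub_def by (elim imageE) (simp only: restr_s_dom)

lemma Vh_sub_a_dom: "v \<in> Vh_sub S i \<Longrightarrow> v \<in> a_dom S (D i)"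
  unfolding Vh_sub_def by (elim imageE) (simp only: restr_a_dom)

lemma nonneg_a_sub: "i \<in> I \<Longrightarrow> nonneg_form (a_dom S (D i)) (a_sub S i)"
  using nonneg_aform[OF elems_mesh, of "D i"] by (simp only: subdomain(3) a_sub_def)

text \<open>Eigenfunctions are restricted functions, whereas \<open>u\<close> lives on the whole
  domain; this passes between the two.\<close>

lemma sform_restr:
  assumes "i \<in> I" "v \<in> Vh S" "w \<in> s_dom S i"
  shows "sform S i (restr (D i) v) w = sform S i v w"
  by (rule sform_cong[OF assms(1) restr_s_dom[OF assms(2)] Vh_s_dom[OF assms(2)] assms(3) ae_eq_on_restr])

text \<open>Congruence changes the first argument only; conjugation brings the second one to the
  front for another application.\<close>

lemma qf_sform_restr:
  assumes "i \<in> I" "v \<in> Vh S"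
  shows "qf (sform S i) (restr (D i) v) = qf (sform S i) v"
proof -
  interpret nonneg_form "s_dom S i" "sform S i" by (rule nonneg_sform[OF assms(1)])
  have v: "v \<in> s_dom S i" "restr (D i) v \<in> s_dom S i" using assms(2) by (auto intro: Vh_s_dom restr_s_dom)
  have "sform S i (restr (D i) v) (restr (D i) v) = Complex.cnj (sform S i (restr (D i) v) v)"
    using sform_restr[OF assms v(2)] cnj[OF v(2,1)] by simp
  also have "\<dots> = sform S i v v"
    using sform_restr[OF assms v(1)] cnj[OF v(1,1)] by simp
  finally show ?thesis by (simp add: qf_def)
qed

lemma qf_a_sub_restr:
  assumes i: "i \<in> I" and v: "v \<in> Vh S"
  shows "qf (a_sub S i) (restr (D i) v) = qf (a_sub S i) v"
proof -
  interpret nonneg_form "a_dom S (D i)" "a_sub S i" by (rule nonneg_a_sub[OF i])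
  have vv: "v \<in> a_dom S (D i)" "restr (D i) v \<in> a_dom S (D i)"
    using v by (auto intro: adm_a_dom Vh_adm restr_a_dom)
  have cong: "a_sub S i (restr (D i) v) w = a_sub S i v w" if "w \<in> a_dom S (D i)" for w
    unfolding a_sub_def
    by (rule aform_cong[OF elems_mesh[of S "D i"], unfolded subdomain(3)[OF i], OF vv(2,1) that ae_eq_on_restr])
  have "a_sub S i (restr (D i) v) (restr (D i) v) = Complex.cnj (a_sub S i (restr (D i) v) v)"
    using cong[OF vv(2)] cnj[OF vv(2,1)] by simp
  also have "\<dots> = a_sub S i v v"
    using cong[OF vv(1)] cnj[OF vv(1,1)] by simp
  finally show ?thesis by (simp add: qf_def)
qed

section \<open>Eigenfunction expansions and auxiliary projections\<close>

lemma eigfun: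
  assumes "i \<in> I" "j \<in> {1..n_sub S i}"
  shows "eigfun S i j \<in> Vh_sub S i" "0 < eigval S i j"
    "l \<in> {1..n_sub S i} \<Longrightarrow> j \<le> l \<Longrightarrow> eigval S i l \<le> eigval S i j"
    "l \<in> {1..n_sub S i} \<Longrightarrow> sform S i (eigfun S i j) (eigfun S i l) = (if j = l then 1 else 0)"
    "l \<in> {1..n_sub S i} \<Longrightarrow> j \<noteq> l \<Longrightarrow> a_sub S i (eigfun S i j) (eigfun S i l) = 0"
    "qf (a_sub S i) (eigfun S i j) = 1 / eigval S i j"
proof -
  note * = eig[unfolded eigenproblems_def, THEN bspec, OF assms(1), THEN bspec, OF assms(2)]
  show m: "eigfun S i j \<in> Vh_sub S i" and p: "0 < eigval S i j" using * by blast+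
  show "l \<in> {1..n_sub S i} \<Longrightarrow> j \<le> l \<Longrightarrow> eigval S i l \<le> eigval S i j"
    "l \<in> {1..n_sub S i} \<Longrightarrow> j \<noteq> l \<Longrightarrow> a_sub S i (eigfun S i j) (eigfun S i l) = 0"
    using * by blast+
  have o: "sform S i (eigfun S i j) (eigfun S i l) = (if j = l then 1 else 0)"
    if "l \<in> {1..n_sub S i}" for l
    using * that by blast
  then show "l \<in> {1..n_sub S i} \<Longrightarrow> sform S i (eigfun S i j) (eigfun S i l) = (if j = l then 1 else 0)" .
  \<comment> \<open>Testing the eigen-equation with its own eigenfunction and using the
    \<open>s\<close>-normalisation gives the energy as the reciprocal eigenvalue.\<close>
  have "sform S i (eigfun S i j) (eigfun S i j) = of_real (eigval S i j) * a_sub S i (eigfun S i j) (eigfun S i j)"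
    using * m by blast
  then have "of_real (eigval S i j) * a_sub S i (eigfun S i j) (eigfun S i j) = 1"
    using o[OF assms(2)] by simp
  then have "a_sub S i (eigfun S i j) (eigfun S i j) = of_real (1 / eigval S i j)"
    using p by (simp add: field_simps)
  then show "qf (a_sub S i) (eigfun S i j) = 1 / eigval S i j" by (simp add: qf_def)
qed

lemma eigfun_s_dom: "i \<in> I \<Longrightarrow> j \<in> {1..n_sub S i} \<Longrightarrow> eigfun S i j \<in> s_dom S i"
  by (rule Vh_sub_s_dom[OF eigfun(1)])

lemma l_sub_eq:
  assumes i: "i \<in> I"
  shows "{j\<in>{1..n_sub S i}. \<Lambda> \<le> eigval S i j} = {1..l_sub S \<Lambda> i}"
  unfolding l_sub_def
proof (rule downward_closed_atLeastAtMost)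
  fix j l assume l: "l \<in> {j\<in>{1..n_sub S i}. \<Lambda> \<le> eigval S i j}" and j: "1 \<le> j" "j \<le> l"
  then have jn: "j \<in> {1..n_sub S i}" by auto
  have "eigval S i l \<le> eigval S i j" using eigfun(3)[OF i jn, of l] l j by auto
  with jn show "j \<in> {j\<in>{1..n_sub S i}. \<Lambda> \<le> eigval S i j}" using l by auto
qed auto

lemma l_sub_le: "i \<in> I \<Longrightarrow> j \<in> {1..l_sub S \<Lambda> i} \<Longrightarrow> j \<in> {1..n_sub S i}"
  using l_sub_eq by blast

text \<open>Trades the Riesz description for a truncated eigenfunction expansion, so that later
  statements about the projection become statements about finitely many coefficients.\<close>

lemma proj_aux_eq:
  assumes i: "i \<in> I" and v: "v \<in> Vh S"
  shows "proj_aux S \<Lambda> i v = (\<Sum>j\<in>{1..l_sub S \<Lambda> i}. cscale (coef i v j) (eigfun S i j))"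
    (is "_ = ?p")
  unfolding proj_aux_def
proof (rule riesz_eqI)
  interpret s: nonneg_form "s_dom S i" "sform S i" by (rule nonneg_sform[OF i])
  let ?J = "{1..l_sub S \<Lambda> i}"
  have ef: "eigfun S i j \<in> Vh_sub S i" "eigfun S i j \<in> s_dom S i" if "j \<in> ?J" for j
    using eigfun(1)[OF i l_sub_le[OF i that]] Vh_sub_s_dom by auto
  have "eigfun S i ` ?J \<subseteq> Vh_sub S i" using ef by auto
  then have "V_aux S \<Lambda> i \<subseteq> Vh_sub S i"
    unfolding V_aux_def by (rule cfun.span_minimal[OF _ subspace_Vh_sub])
  then show "pos_form (V_aux S \<Lambda> i) (sform S i)"
    by (rule pos_form.pos_form_subset[OF pos_sform[OF i], rotated]) (simp add: V_aux_def)
  show "?p \<in> V_aux S \<Lambda> i"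
    unfolding V_aux_def by (intro cfun.span_sum cfun.span_scale cfun.span_base imageI)
  have vs: "v \<in> s_dom S i" by (rule Vh_s_dom[OF v])
  have ps: "?p \<in> s_dom S i" using ef by (intro s.mem_sum s.mem)
  have "sform S i (v - ?p) (eigfun S i l) = 0" if l: "l \<in> ?J" for l
  proof -
    have "sform S i ?p (eigfun S i l) = (\<Sum>j\<in>?J. coef i v j * sform S i (eigfun S i j) (eigfun S i l))"
      using ef l by (subst s.sum_left) (auto simp: s.scale_left)
    also have "\<dots> = (\<Sum>j\<in>?J. if j = l then coef i v l else 0)"
      using eigfun(4)[OF i] l_sub_le[OF i] l by (intro sum.cong refl) auto
    also have "\<dots> = coef i v l" using l by simp
    finally show ?thesis using s.diff_left[OF vs ps ef(2)[OF l]] by simp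
  qed
  then have "eigfun S i ` ?J \<subseteq> {w\<in>s_dom S i. sform S i (v - ?p) w = 0}" using ef by auto
  then have "V_aux S \<Lambda> i \<subseteq> {w\<in>s_dom S i. sform S i (v - ?p) w = 0}"
    unfolding V_aux_def by (rule cfun.span_minimal[OF _ s.subspace_annihilator(1)[OF s.mem(3)[OF vs ps]]])
  then show "sform S i ?p w = sform S i v w" if "w \<in> V_aux S \<Lambda> i" for w
    using s.diff_left[OF vs ps, of w] that by auto
qed

lemma sform_proj_aux:
  assumes i: "i \<in> I" and "u \<in> Vh S" "v \<in> Vh S"
  shows "sform S i (proj_aux S \<Lambda> i u) (proj_aux S \<Lambda> i v)
    = (\<Sum>j\<in>{1..l_sub S \<Lambda> i}. coef i u j * cnj (coef i v j))"
proof -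
  interpret s: nonneg_form "s_dom S i" "sform S i" by (rule nonneg_sform[OF i])
  have "sform S i (proj_aux S \<Lambda> i u) (proj_aux S \<Lambda> i v)
    = (\<Sum>j\<in>{1..l_sub S \<Lambda> i}. coef i u j * cnj (coef i v j) * sform S i (eigfun S i j) (eigfun S i j))"
    unfolding proj_aux_eq[OF i assms(2)] proj_aux_eq[OF i assms(3)]
    by (rule s.orthogonal_sum) (use eigfun_s_dom[OF i] eigfun(4)[OF i] l_sub_le[OF i] in auto)
  also have "\<dots> = (\<Sum>j\<in>{1..l_sub S \<Lambda> i}. coef i u j * cnj (coef i v j))"
    by (intro sum.cong refl) (use eigfun(4)[OF i] l_sub_le[OF i] in auto)
  finally show ?thesis .
qed

lemma qf_sform_proj_aux:
  assumes "i \<in> I" "u \<in> Vh S"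
  shows "qf (sform S i) (proj_aux S \<Lambda> i u) = (\<Sum>j\<in>{1..l_sub S \<Lambda> i}. (cmod (coef i u j))\<^sup>2)"
  unfolding qf_def sform_proj_aux[OF assms(1,2,2)] by (simp flip: complex_norm_square)

text \<open>The components of \<open>v\<close> along the discarded eigenfunctions are controlled by the energy,
  because their eigenvalues lie below the threshold.\<close>

lemma qf_sform_le:
  assumes i: "i \<in> I" and v: "v \<in> Vh S"
  shows "qf (sform S i) v \<le> qf (sform S i) (proj_aux S \<Lambda> i v) + \<Lambda> * qf (a_sub S i) v"
proof -
  let ?n = "{1..n_sub S i}" and ?l = "{1..l_sub S \<Lambda> i}"
  let ?c = "\<lambda>j. (cmod (coef i v j))\<^sup>2"
  interpret s: pos_form "Vh_sub S i" "sform S i" by (rule pos_sform[OF i])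
  interpret a: nonneg_form "a_dom S (D i)" "a_sub S i" by (rule nonneg_a_sub[OF i])
  define r where "r = restr (D i) v"
  have r: "r \<in> Vh_sub S i" unfolding r_def Vh_sub_def using v by (rule imageI)
  have "r = (\<Sum>j\<in>?n. cscale (sform S i r (eigfun S i j)) (eigfun S i j))"
    by (rule s.orthonormal_expansion[OF fin_dim_Vh_sub])
      (use r eigfun(1,4)[OF i] in \<open>auto simp: n_sub_def\<close>)
  also have "\<dots> = (\<Sum>j\<in>?n. cscale (coef i v j) (eigfun S i j))"
    unfolding r_def using sform_restr[OF i v eigfun_s_dom[OF i]] by (intro sum.cong refl) simp
  finally have r_eq: "r = (\<Sum>j\<in>?n. cscale (coef i v j) (eigfun S i j))" .
  have "qf (sform S i) v = qf (sform S i) r" by (simp only: r_def qf_sform_restr[OF i v])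
  also have "\<dots> = (\<Sum>j\<in>?n. ?c j * qf (sform S i) (eigfun S i j))"
    unfolding r_eq by (rule s.qf_orthogonal_sum) (use eigfun(1,4)[OF i] in auto)
  also have "\<dots> = (\<Sum>j\<in>?n. ?c j)"
    using eigfun(4)[OF i] by (intro sum.cong refl) (simp add: qf_def)
  finally have sv: "qf (sform S i) v = (\<Sum>j\<in>?n. ?c j)" .
  have "qf (a_sub S i) v = qf (a_sub S i) r" by (simp only: r_def qf_a_sub_restr[OF i v])
  also have "\<dots> = (\<Sum>j\<in>?n. ?c j * qf (a_sub S i) (eigfun S i j))"
    unfolding r_eq by (rule a.qf_orthogonal_sum) (use eigfun(1,5)[OF i] in \<open>auto intro: Vh_sub_a_dom\<close>)
  also have "\<dots> = (\<Sum>j\<in>?n. ?c j / eigval S i j)"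
    using eigfun(6)[OF i] by (intro sum.cong refl) simp
  finally have av: "qf (a_sub S i) v = (\<Sum>j\<in>?n. ?c j / eigval S i j)" .
  \<comment> \<open>Termwise: a retained index pays with its own coefficient, a discarded one with
    \<open>\<Lambda>\<close> times its share of the energy.\<close>
  have "(\<Sum>j\<in>?n. ?c j) \<le> (\<Sum>j\<in>?n. (if j \<in> ?l then ?c j else 0) + \<Lambda> * (?c j / eigval S i j))"
  proof (rule sum_mono)
    fix j assume j: "j \<in> ?n"
    have pos: "0 < eigval S i j" by (rule eigfun(2)[OF i j])
    show "?c j \<le> (if j \<in> ?l then ?c j else 0) + \<Lambda> * (?c j / eigval S i j)"
    proof (cases "j \<in> ?l")
      case True
      then show ?thesis using pos Lambda by simp
    next
      case False
      then have "eigval S i j < \<Lambda>" using l_sub_eq[OF i] j by force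
      then have "?c j * eigval S i j \<le> ?c j * \<Lambda>" by (intro mult_left_mono) auto
      then have "?c j \<le> \<Lambda> * (?c j / eigval S i j)" using pos by (simp add: field_simps)
      then show ?thesis by (simp only: if_not_P[OF False] add_0)
    qed
  qed
  also have "\<dots> = (\<Sum>j\<in>?n. if j \<in> ?l then ?c j else 0) + \<Lambda> * qf (a_sub S i) v"
    by (simp add: sum.distrib sum_distrib_left av)
  also have "(\<Sum>j\<in>?n. if j \<in> ?l then ?c j else 0) = (\<Sum>j\<in>?l. ?c j)"
  proof -
    have "?n \<inter> ?l = ?l" using l_sub_le[OF i] by blast
    then show ?thesis by (subst sum.inter_restrict[symmetric]) auto
  qed
  also have "\<dots> = qf (sform S i) (proj_aux S \<Lambda> i v)" by (simp only: qf_sform_proj_aux[OF i v])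
  finally show ?thesis unfolding sv .
qed

section \<open>Well-posedness of the coarse basis\<close>

lemma bform_eq:
  assumes "u \<in> Vh S" "v \<in> Vh S"
  shows "bform S \<Lambda> u v = a_full S u v + (\<Sum>i\<in>I. \<Sum>j\<in>{1..l_sub S \<Lambda> i}. coef i u j * cnj (coef i v j))"
  unfolding bform_def using sform_proj_aux assms by (intro arg_cong2[where f="(+)"] refl sum.cong) auto

lemma coef_add:
  assumes "i \<in> I" "j \<in> {1..l_sub S \<Lambda> i}" "u \<in> Vh S" "v \<in> Vh S"
  shows "coef i (u + v) j = coef i u j + coef i v j"
proof -
  interpret nonneg_form "s_dom S i" "sform S i" by (rule nonneg_sform[OF assms(1)])
  show ?thesis
    by (rule add_left[OF Vh_s_dom[OF assms(3)] Vh_s_dom[OF assms(4)] eigfun_s_dom[OF assms(1) l_sub_le[OF assms(1,2)]]])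
qed

lemma coef_cscale:
  assumes "i \<in> I" "j \<in> {1..l_sub S \<Lambda> i}" "u \<in> Vh S"
  shows "coef i (cscale t u) j = t * coef i u j"
proof -
  interpret nonneg_form "s_dom S i" "sform S i" by (rule nonneg_sform[OF assms(1)])
  show ?thesis
    by (rule scale_left[OF Vh_s_dom[OF assms(3)] eigfun_s_dom[OF assms(1) l_sub_le[OF assms(1,2)]]])
qed

text \<open>The energy part is already definite and the projected part adds a nonnegative sum. This
  is what gives the description in \<open>psi_bar\<close> a value.\<close>

lemma pos_bform: "pos_form (Vh S) (bform S \<Lambda>)"
proof (rule pos_formI[OF subspace_Vh])
  let ?c = "\<lambda>u v. \<Sum>i\<in>I. \<Sum>j\<in>{1..l_sub S \<Lambda> i}. coef i u j * cnj (coef i v j)"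
  have add: "bform S \<Lambda> (u + v) w = bform S \<Lambda> u w + bform S \<Lambda> v w"
    if "u \<in> Vh S" "v \<in> Vh S" "w \<in> Vh S" for u v w
  proof -
    have "?c (u + v) w = (\<Sum>i\<in>I. \<Sum>j\<in>{1..l_sub S \<Lambda> i}. coef i u j * cnj (coef i w j) + coef i v j * cnj (coef i w j))"
      using that by (intro sum.cong refl) (simp only: coef_add distrib_right)
    then show ?thesis using that by (simp only: bform_eq a.mem a.add_left sum.distrib) (simp only: add_ac)
  qed
  have scale: "bform S \<Lambda> (cscale t u) w = t * bform S \<Lambda> u w"
    if "u \<in> Vh S" "w \<in> Vh S" for t u w
  proof -
    have "?c (cscale t u) w = (\<Sum>i\<in>I. \<Sum>j\<in>{1..l_sub S \<Lambda> i}. t * (coef i u j * cnj (coef i w j)))"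
      using that by (intro sum.cong refl) (simp only: coef_cscale mult.assoc)
    then show ?thesis using that by (simp only: bform_eq a.mem a.scale_left sum_distrib_left distrib_left)
  qed
  have herm: "bform S \<Lambda> v u = cnj (bform S \<Lambda> u v)" if "u \<in> Vh S" "v \<in> Vh S" for u v
    using a.cnj[OF that] that by (simp add: bform_eq mult.commute)
  have pos: "0 < qf (bform S \<Lambda>) u" if "u \<in> Vh S" "u \<noteq> 0" for u
  proof -
    have "0 \<le> Re (?c u u)" by (auto intro!: sum_nonneg simp flip: complex_norm_square)
    then show ?thesis using a.pos[OF that] that(1) unfolding qf_def by (simp only: bform_eq plus_complex.sel)
  qed
  show "pos_def_form_on (Vh S) (bform S \<Lambda>)"
    unfolding pos_def_form_on_def hermitian_form_on_def
    by (intro conjI ballI allI impI add scale herm pos)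
qed

lemma psi_bar_Vh:
  assumes i: "i \<in> I" and j: "j \<in> {1..l_sub S \<Lambda> i}"
  shows "psi_bar S \<Lambda> k i j \<in> Vh S"
proof -
  let ?W = "Vh_supp S (layer_region S k i)"
  interpret s: nonneg_form "s_dom S i" "sform S i" by (rule nonneg_sform[OF i])
  have W: "?W \<subseteq> Vh S" by (auto simp: Vh_supp_def)
  \<comment> \<open>The functional only reads off the conjugate of one coefficient, which exposes
    its conjugate-linearity.\<close>
  have f: "sform S i (eigfun S i j) (proj_aux S \<Lambda> i v) = cnj (coef i v j)" if v: "v \<in> Vh S" for v
  proof -
    let ?J = "{1..l_sub S \<Lambda> i}"
    have ef: "eigfun S i l \<in> s_dom S i" if "l \<in> ?J" for l
      by (rule eigfun_s_dom[OF i l_sub_le[OF i that]])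
    have "sform S i (eigfun S i j) (proj_aux S \<Lambda> i v)
        = (\<Sum>l\<in>?J. cnj (coef i v l) * sform S i (eigfun S i j) (eigfun S i l))"
      unfolding proj_aux_eq[OF i v] using ef j by (subst s.sum_right) (auto simp: s.scale_right)
    also have "\<dots> = (\<Sum>l\<in>?J. if l = j then cnj (coef i v j) else 0)"
      using eigfun(4)[OF i] l_sub_le[OF i] j by (intro sum.cong refl) auto
    also have "\<dots> = cnj (coef i v j)" using j by simp
    finally show ?thesis .
  qed
  have "conj_linear_on ?W (\<lambda>v. sform S i (eigfun S i j) (proj_aux S \<Lambda> i v))"
    unfolding conj_linear_on_def
  proof (intro conjI ballI allI)
    fix u v assume uv: "u \<in> ?W" "v \<in> ?W"
    have uv': "u \<in> Vh S" "v \<in> Vh S" using uv W by auto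
    show "sform S i (eigfun S i j) (proj_aux S \<Lambda> i (u + v))
        = sform S i (eigfun S i j) (proj_aux S \<Lambda> i u) + sform S i (eigfun S i j) (proj_aux S \<Lambda> i v)"
      unfolding f[OF uv'(1)] f[OF uv'(2)] f[OF a.mem(2)[OF uv']] coef_add[OF i j uv'] by simp
  next
    fix t u assume "u \<in> ?W"
    then have u: "u \<in> Vh S" using W by auto
    show "sform S i (eigfun S i j) (proj_aux S \<Lambda> i (cscale t u))
        = cnj t * sform S i (eigfun S i j) (proj_aux S \<Lambda> i u)"
      unfolding f[OF u] f[OF a.mem(4)[OF u]] coef_cscale[OF i j u] by simp
  qed
  moreover have "pos_form ?W (bform S \<Lambda>)" "fin_dim ?W"
    using pos_form.pos_form_subset[OF pos_bform subspace_Vh_supp W]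
      fin_dim_subspace[OF fin_dim_Vh subspace_Vh_supp W] by auto
  ultimately have "psi_bar S \<Lambda> k i j \<in> ?W" unfolding psi_bar_def by (intro riesz_mem)
  then show ?thesis using W by blast
qed

lemma V_coarse_Vh: "V_coarse S \<Lambda> k \<subseteq> Vh S"
  unfolding V_coarse_def by (rule cfun.span_minimal[OF _ subspace_Vh]) (auto intro!: psi_bar_Vh)

lemma V_aux_s_dom:
  assumes "i \<in> I"
  shows "V_aux S \<Lambda> i \<subseteq> s_dom S i"
proof -
  interpret nonneg_form "s_dom S i" "sform S i" by (rule nonneg_sform[OF assms])
  show ?thesis
    unfolding V_aux_def
    by (rule cfun.span_minimal[OF _ subspace]) (use eigfun_s_dom[OF assms] l_sub_le[OF assms] in auto)
qed

lemma subspace_V_tilde: "cfun.subspace (V_tilde S \<Lambda>)"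
proof (rule cfun.subspaceI)
  show "0 \<in> V_tilde S \<Lambda>"
    unfolding V_tilde_def
    using nonneg_sform nonneg_form.axioms(1)[THEN herm_form.zero_left] V_aux_s_dom by blast
next
  fix u v assume uv: "u \<in> V_tilde S \<Lambda>" "v \<in> V_tilde S \<Lambda>"
  then have uv': "u \<in> Vh S" "v \<in> Vh S" by (simp_all add: V_tilde_def)
  have "sform S i (u + v) w = 0" if i: "i \<in> I" and w: "w \<in> V_aux S \<Lambda> i" for i w
  proof -
    interpret nonneg_form "s_dom S i" "sform S i" by (rule nonneg_sform[OF i])
    have "sform S i u w = 0" "sform S i v w = 0" using uv i w by (simp_all add: V_tilde_def)
    then show ?thesis
      using add_left[OF Vh_s_dom[OF uv'(1)] Vh_s_dom[OF uv'(2)] subsetD[OF V_aux_s_dom[OF i] w]] by simp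
  qed
  then show "u + v \<in> V_tilde S \<Lambda>"
    unfolding V_tilde_def using a.mem(2)[OF uv'] by (intro CollectI conjI ballI)
next
  fix t u assume u: "u \<in> V_tilde S \<Lambda>"
  then have u': "u \<in> Vh S" by (simp add: V_tilde_def)
  have "sform S i (cscale t u) w = 0" if i: "i \<in> I" and w: "w \<in> V_aux S \<Lambda> i" for i w
  proof -
    interpret nonneg_form "s_dom S i" "sform S i" by (rule nonneg_sform[OF i])
    have "sform S i u w = 0" using u i w by (simp add: V_tilde_def)
    then show ?thesis
      using scale_left[OF Vh_s_dom[OF u'] subsetD[OF V_aux_s_dom[OF i] w]] by simp
  qed
  then show "cscale t u \<in> V_tilde S \<Lambda>"
    unfolding V_tilde_def using a.mem(4)[OF u'] by (intro CollectI conjI ballI)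
qed

text \<open>The component of \<open>u\<close> in \<open>V_tilde\<close> is invisible to the projections, and the complementary
  component has smaller energy, so that Assumption 3 extends from \<open>V_zero\<close> to all of \<open>V_h\<close>.\<close>

lemma sum_qf_proj_aux_le:
  assumes u: "u \<in> Vh S"
  shows "(\<Sum>i\<in>I. qf (sform S i) (proj_aux S \<Lambda> i u)) \<le> c * (Cp * qf (a_full S) u)"
proof -
  let ?W = "V_tilde S \<Lambda>"
  have W: "?W \<subseteq> Vh S" by (auto simp: V_tilde_def)
  define p where "p = riesz (a_full S) ?W (a_full S u)"
  have aW: "pos_form ?W (a_full S)" and fW: "fin_dim ?W"
    using a.pos_form_subset[OF subspace_V_tilde W] fin_dim_subspace[OF fin_dim_Vh subspace_V_tilde W] by auto
  note cl = a.conj_linear_on_form[OF u W]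
  have p: "p \<in> ?W" unfolding p_def by (rule riesz_mem[OF aW fW cl])
  have pe: "a_full S p v = a_full S u v" if "v \<in> ?W" for v
    unfolding p_def by (rule riesz_eq[OF aW fW cl that])
  have pV: "p \<in> Vh S" using p W by blast
  define z where "z = u - p"
  have z: "z \<in> Vh S" unfolding z_def by (rule a.mem(3)[OF u pV])
  have zW: "a_full S z v = 0" if v: "v \<in> ?W" for v
    unfolding z_def using a.diff_left[OF u pV subsetD[OF W v]] pe[OF v] by simp
  then have z0: "z \<in> V_zero S \<Lambda>" unfolding V_zero_def using z by blast
  have uzp: "u = z + p" by (simp add: z_def)
  have "qf (a_full S) u = qf (a_full S) z + qf (a_full S) p"
    unfolding uzp using a.qf_add[OF z pV] zW[OF p] by simp
  then have az: "qf (a_full S) z \<le> qf (a_full S) u" using a.nonneg[OF pV] by simp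
  have "qf (sform S i) (proj_aux S \<Lambda> i u) = qf (sform S i) (proj_aux S \<Lambda> i z)" if i: "i \<in> I" for i
  proof -
    have "coef i u j = coef i z j" if j: "j \<in> {1..l_sub S \<Lambda> i}" for j
    proof -
      have "eigfun S i j \<in> V_aux S \<Lambda> i" unfolding V_aux_def using j by (intro cfun.span_base imageI)
      then have "coef i p j = 0" using p i by (simp add: V_tilde_def)
      then show ?thesis unfolding uzp using coef_add[OF i j z pV] by simp
    qed
    then show ?thesis by (simp only: qf_sform_proj_aux[OF i u] qf_sform_proj_aux[OF i z] cong: sum.cong)
  qed
  then have "(\<Sum>i\<in>I. qf (sform S i) (proj_aux S \<Lambda> i u)) = (\<Sum>i\<in>I. qf (sform S i) (proj_aux S \<Lambda> i z))"
    by (rule sum.cong[OF refl])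
  also have "\<dots> \<le> c * (Cp * qf (a_full S) z)"
    using as3 z0 unfolding assumption3_def by blast
  also have "\<dots> \<le> c * (Cp * qf (a_full S) u)"
    using as3 az unfolding assumption3_def by (intro mult_left_mono) auto
  finally show ?thesis .
qed

section \<open>Stability of the interpolated decomposition\<close>

lemma interp_add:
  assumes "u \<in> L2_on (Omega S)" "v \<in> L2_on (Omega S)"
  shows "interp S (u + v) = interp S u + interp S v"
proof -
  have "\<forall>u\<in>L2_on (Omega S). \<forall>v\<in>L2_on (Omega S). interp S (u + v) = interp S u + interp S v"
    using as2 unfolding assumption2_def by (elim conjE)
  from bspec[OF bspec[OF this assms(1)] assms(2)] show ?thesis .
qed

text \<open>Square integrability of the partial sum is carried along, since each induction step
  applies \<open>interp_add\<close> to it.\<close>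

lemma interp_sum:
  assumes "finite J" "\<And>j. j \<in> J \<Longrightarrow> f j \<in> L2_on (Omega S)"
  shows "sum f J \<in> L2_on (Omega S) \<and> interp S (sum f J) = (\<Sum>j\<in>J. interp S (f j))"
  using assms
proof (induction J rule: finite_induct)
  case empty
  show ?case using interp_add[OF zero_L2_on zero_L2_on] zero_L2_on by (simp add: zero_fun_def[symmetric])
next
  case (insert j J)
  then have "f j \<in> L2_on (Omega S)" "sum f J \<in> L2_on (Omega S)"
    "interp S (sum f J) = (\<Sum>j\<in>J. interp S (f j))" by simp_all
  then show ?case
    unfolding sum.insert[OF insert.hyps] using L2_on_add interp_add by metis
qed

lemma interp_cutoff_Vh_ovl: "j \<in> I \<Longrightarrow> u \<in> Vh S \<Longrightarrow> interp S (cutoff j u) \<in> Vh_ovl S j"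
  using as2 unfolding assumption2_def by blast

lemma sum_interp_cutoff:
  assumes "u \<in> Vh S"
  shows "(\<Sum>j\<in>I. interp S (cutoff j u)) = u"
proof -
  have "interp S (\<Sum>j\<in>I. cutoff j u) = (\<Sum>j\<in>I. interp S (cutoff j u))"
    using interp_sum[of I "\<lambda>j. cutoff j u"] cutoff_L2 assms by blast
  moreover have "interp S u = u" using as2 assms unfolding assumption2_def by blast
  ultimately show ?thesis unfolding sum_cutoff[OF assms] by (rule trans[OF sym])
qed

text \<open>Sums the elementwise bound over the mesh. No sign is prescribed for \<open>CIa\<close>;
  \<open>max 1 CIa\<close> is a positive constant that is still valid because element energies are
  nonnegative.\<close>

lemma qf_interp_cutoff_le:
  assumes j: "j \<in> I" and u: "u \<in> Vh S"
  shows "qf (a_full S) (interp S (cutoff j u)) \<le> max 1 CIa * qf (a_full S) (cutoff j u)"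
proof -
  have w: "cutoff j u \<in> cutoff_products S" by (rule cutoff_products[OF j u])
  have adm: "cutoff j u \<in> adm" "interp S (cutoff j u) \<in> adm"
    using cutoff_adm[OF w] Vh_adm[OF subsetD[OF Vh_ovl_Vh interp_cutoff_Vh_ovl[OF j u]]] by auto
  have bnd: "qf (aform S \<tau>) (interp S (cutoff j u)) \<le> max 1 CIa * qf (aform S \<tau>) (cutoff j u)"
    if \<tau>: "\<tau> \<in> mesh S" for \<tau>
  proof -
    have "qf (aform S \<tau>) (interp S (cutoff j u)) \<le> CIa * qf (aform S \<tau>) (cutoff j u)"
      using as2 w \<tau> unfolding assumption2_def by blast
    also have "\<dots> \<le> max 1 CIa * qf (aform S \<tau>) (cutoff j u)"
      using qf_element_nonneg[OF \<tau> adm(1)] by (intro mult_right_mono) auto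
    finally show ?thesis .
  qed
  have "qf (a_full S) (interp S (cutoff j u)) = (\<Sum>\<tau>\<in>mesh S. qf (aform S \<tau>) (interp S (cutoff j u)))"
    by (rule qf_a_full_elements[OF adm(2)])
  also have "\<dots> \<le> (\<Sum>\<tau>\<in>mesh S. max 1 CIa * qf (aform S \<tau>) (cutoff j u))" by (rule sum_mono[OF bnd])
  also have "\<dots> = max 1 CIa * qf (a_full S) (cutoff j u)"
    unfolding sum_distrib_left[symmetric] qf_a_full_elements[OF adm(1)] ..
  finally show ?thesis .
qed

text \<open>The factors come from interpolation, from a single cutoff and from the number of cutoffs
  reaching a subdomain. In the last one, 1 pays for the energy itself, \<open>\<Lambda>\<close> for
  the discarded modes and \<open>c * Cp\<close> for the retained ones.\<close>

abbreviation "stab \<equiv> max 1 CIa * (Ct * (real (max_ovl S) * (1 + \<Lambda> + c * Cp)))"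

lemma stab_pos: "0 < stab"
proof -
  have "0 < c * Cp" using as3 unfolding assumption3_def by simp
  then show ?thesis using Lambda Ct_pos max_ovl_pos by (intro mult_pos_pos) auto
qed

lemma stable_decomposition:
  assumes u: "u \<in> Vh S"
  shows "(\<Sum>j\<in>I. qf (a_full S) (interp S (cutoff j u))) \<le> stab * qf (a_full S) u"
proof -
  let ?e = "\<lambda>i. qf (a_sub S i) u + qf (sform S i) u"
  let ?n = "\<lambda>i j. if j \<in> ovl_idx S i then 1 else 0 :: real"
  have e: "0 \<le> ?e i" if i: "i \<in> I" for i
    using nonneg_form.nonneg[OF nonneg_a_sub[OF i] adm_a_dom[OF Vh_adm[OF u]]]
      nonneg_form.nonneg[OF nonneg_sform[OF i] Vh_s_dom[OF u]] by simp
  have a_u: "qf (a_full S) u = (\<Sum>i\<in>I. qf (a_sub S i) u)"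
    by (rule qf_a_full_subdomains[OF Vh_adm[OF u]])
  have cut: "qf (a_full S) (cutoff j u) \<le> (\<Sum>i\<in>I. Ct * (?n i j * ?e i))" if j: "j \<in> I" for j
  proof -
    have adm: "cutoff j u \<in> adm" by (rule cutoff_adm[OF cutoff_products[OF j u]])
    have "qf (a_full S) (cutoff j u) = (\<Sum>i\<in>I. qf (a_sub S i) (cutoff j u))"
      by (rule qf_a_full_subdomains[OF adm])
    also have "\<dots> \<le> (\<Sum>i\<in>I. Ct * (?n i j * ?e i))"
    proof (rule sum_mono)
      fix i assume i: "i \<in> I"
      show "qf (a_sub S i) (cutoff j u) \<le> Ct * (?n i j * ?e i)"
      proof (cases "j \<in> ovl_idx S i")
        case True
        then show ?thesis using as1D(4)[OF i] u by simp
      next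
        case False
        then show ?thesis using qf_a_sub_cutoff_eq_0[OF i j False u] by simp
      qed
    qed
    finally show ?thesis .
  qed
  \<comment> \<open>After the swap, the inner sum for a fixed subdomain counts the cutoffs that
    reach it.\<close>
  have "(\<Sum>j\<in>I. \<Sum>i\<in>I. Ct * (?n i j * ?e i)) = Ct * (\<Sum>i\<in>I. (\<Sum>j\<in>I. ?n i j) * ?e i)"
    by (subst sum.swap) (simp only: sum_distrib_left sum_distrib_right)
  also have "\<dots> \<le> Ct * (\<Sum>i\<in>I. real (max_ovl S) * ?e i)"
  proof (intro mult_left_mono sum_mono mult_right_mono)
    fix i assume i: "i \<in> I"
    have "ovl_idx S i \<subseteq> I" by (auto simp: ovl_idx_def)
    then show "(\<Sum>j\<in>I. ?n i j) \<le> real (max_ovl S)"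
      using card_ovl_idx_le[OF i] by (simp add: sum.If_cases Int_absorb1)
    show "0 \<le> ?e i" by (rule e[OF i])
  qed (use Ct_pos in auto)
  also have "(\<Sum>i\<in>I. real (max_ovl S) * ?e i) = real (max_ovl S) * (\<Sum>i\<in>I. ?e i)"
    by (rule sum_distrib_left[symmetric])
  also have "Ct * \<dots> \<le> Ct * (real (max_ovl S) * ((1 + \<Lambda> + c * Cp) * qf (a_full S) u))"
  proof (intro mult_left_mono)
    have "(\<Sum>i\<in>I. qf (sform S i) u)
        \<le> (\<Sum>i\<in>I. qf (sform S i) (proj_aux S \<Lambda> i u) + \<Lambda> * qf (a_sub S i) u)"
      by (intro sum_mono qf_sform_le u)
    also have "\<dots> = (\<Sum>i\<in>I. qf (sform S i) (proj_aux S \<Lambda> i u)) + \<Lambda> * qf (a_full S) u"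
      unfolding a_u by (simp only: sum.distrib sum_distrib_left)
    finally show "(\<Sum>i\<in>I. ?e i) \<le> (1 + \<Lambda> + c * Cp) * qf (a_full S) u"
      using sum_qf_proj_aux_le[OF u] a_u by (simp add: sum.distrib algebra_simps)
  qed (use Ct_pos in auto)
  finally have cuts: "(\<Sum>j\<in>I. \<Sum>i\<in>I. Ct * (?n i j * ?e i))
      \<le> Ct * (real (max_ovl S) * ((1 + \<Lambda> + c * Cp) * qf (a_full S) u))" .
  have "(\<Sum>j\<in>I. qf (a_full S) (interp S (cutoff j u))) \<le> (\<Sum>j\<in>I. max 1 CIa * qf (a_full S) (cutoff j u))"
    by (intro sum_mono qf_interp_cutoff_le u)
  also have "\<dots> = max 1 CIa * (\<Sum>j\<in>I. qf (a_full S) (cutoff j u))" by (rule sum_distrib_left[symmetric])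
  also have "\<dots> \<le> max 1 CIa * (\<Sum>j\<in>I. \<Sum>i\<in>I. Ct * (?n i j * ?e i))"
    by (intro mult_left_mono sum_mono cut) auto
  also have "\<dots> \<le> max 1 CIa * (Ct * (real (max_ovl S) * ((1 + \<Lambda> + c * Cp) * qf (a_full S) u)))"
    using cuts by (intro mult_left_mono) auto
  finally show ?thesis by (simp only: mult.assoc)
qed

lemma cond_number_le_stab:
  "cond_number (Vh S) (B_inv S \<Lambda> k \<circ> A_h S) \<le> ennreal ((real (max_ovl S) + 1) * stab)"
proof (rule cond_number_le[OF stab_pos])
  fix \<mu> assume "\<mu> \<in> eigenvalues_on (Vh S) (B_inv S \<Lambda> k \<circ> A_h S)"
  then obtain u where u: "u \<in> Vh S" "u \<noteq> 0" and Tu: "B_inv S \<Lambda> k (A_h S u) = cscale \<mu> u"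
    unfolding eigenvalues_on_def by (auto simp: o_def)
  \<comment> \<open>By \<open>subspace_solve\<close> these terms are the energy projections of
    \<open>u\<close> onto the local spaces, and \<open>P0\<close> is the one onto the coarse
    space.\<close>
  define P where "P j = inv_into (Vh_ovl S j) (A_loc S j) (incl_adj (Vh_ip S) (Vh_ovl S j) (A_h S u))" for j
  define P0 where "P0 = inv_into (V_coarse S \<Lambda> k) (A_coarse S \<Lambda> k)
      (incl_adj (Vh_ip S) (V_coarse S \<Lambda> k) (A_h S u))"
  note solve = pos_Vh_ip a.pos_form_axioms fin_dim_Vh
  have P: "P j \<in> Vh_ovl S j" "\<And>v. v \<in> Vh_ovl S j \<Longrightarrow> a_full S (P j) v = a_full S u v" if j: "j \<in> I" for j
  proof -
    have W: "cfun.subspace (Vh_ovl S j)" unfolding Vh_ovl_def by (rule subspace_Vh_supp)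
    have a': "aform S (closure (ovl S j)) w v = a_full S w v" if "w \<in> Vh_ovl S j" "v \<in> Vh_ovl S j" for w v
      by (rule aform_ovl[OF j that(1) subsetD[OF Vh_ovl_Vh that(2)]])
    show "P j \<in> Vh_ovl S j" unfolding P_def A_loc_def A_h_def
      by (rule subspace_solve_mem[OF solve W Vh_ovl_Vh u(1) a'])
    show "a_full S (P j) v = a_full S u v" if "v \<in> Vh_ovl S j" for v
      unfolding P_def A_loc_def A_h_def
      by (rule subspace_solve_eq[OF solve W Vh_ovl_Vh u(1) a' that])
  qed
  have W0: "cfun.subspace (V_coarse S \<Lambda> k)" unfolding V_coarse_def by (rule cfun.subspace_span)
  have P0: "P0 \<in> V_coarse S \<Lambda> k" unfolding P0_def A_coarse_def A_h_def
    by (rule subspace_solve_mem[OF solve W0 V_coarse_Vh u(1) refl])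
  have P0': "a_full S P0 v = a_full S u v" if "v \<in> V_coarse S \<Lambda> k" for v
    unfolding P0_def A_coarse_def A_h_def
    by (rule subspace_solve_eq[OF solve W0 V_coarse_Vh u(1) refl that])
  have T: "(\<Sum>j\<in>I. P j) + P0 = cscale \<mu> u"
    using Tu unfolding B_inv_def P_def P0_def .
  have N: "ovl_idx S j \<subseteq> I" for j by (auto simp: ovl_idx_def)
  note schwarz = additive_schwarz_eigenvalue[OF a.pos_form_axioms finite_atLeastAtMost max_ovl_pos stab_pos u
      Vh_ovl_Vh V_coarse_Vh P P0 P0' N card_ovl_idx_le ovl_idx_sym a_full_orthogonal
      interp_cutoff_Vh_ovl[OF _ u(1)] sum_interp_cutoff[OF u(1)] stable_decomposition[OF u(1)] T]
  show "cmod \<mu> \<le> real (max_ovl S) + 1 \<and> 1 \<le> stab * cmod \<mu>"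
    by (intro conjI schwarz)
qed

end

theorem corollary2p14:
  fixes Ct CIa CIs Cp c :: real
  shows "\<exists>K :: real \<Rightarrow> nat \<Rightarrow> real.
    \<forall>(S :: (real ^ 'd) schwarz) (\<Lambda> :: real) (k :: nat).
      1 < \<Lambda> \<and> 2 \<le> k \<and>
      geometry S \<and> spaces_and_forms S \<and> partition_of_unity S \<and> eigenproblems S \<and>
      assumption1 S Ct \<and> assumption2 S CIa CIs \<and> assumption3 S \<Lambda> Cp c \<longrightarrow>
      cond_number (Vh S) (B_inv S \<Lambda> k \<circ> A_h S) \<le> ennreal (K \<Lambda> (max_ovl S))"
proof (intro exI allI impI, elim conjE)
  fix S :: "(real ^ 'd) schwarz" and \<Lambda> :: real and k :: nat
  assume "1 < \<Lambda>" "geometry S" "spaces_and_forms S" "partition_of_unity S" "eigenproblems S"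
    "assumption1 S Ct" "assumption2 S CIa CIs" "assumption3 S \<Lambda> Cp c"
  then interpret two_level_schwarz S \<Lambda> Ct CIa CIs Cp c k by unfold_locales
  \<comment> \<open>The bound is an explicit beta-redex so that the witness left open by
    \<open>exI\<close> is this function of \<open>\<Lambda>\<close> and M, built from constants
    fixed before \<open>S\<close> is chosen.\<close>
  show "cond_number (Vh S) (B_inv S \<Lambda> k \<circ> A_h S) \<le> ennreal ((\<lambda>\<Lambda> M. (real M + 1) *
      (max 1 CIa * (Ct * (real M * (1 + \<Lambda> + c * Cp))))) \<Lambda> (max_ovl S))"
    using cond_number_le_stab .
qed

end
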